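(* Let $m,a,\theta,b>0$ be real numbers. Let $S$ and $I$ be independent positive random variables such that $S$ has the Gamma distribution with shape parameter $m$ and scale parameter $\theta$, and $I^{-1}$ has the Gamma distribution with shape parameter $a$ and scale parameter $1/b$. Then for every $\gamma_n>0$, $$\mathbf{P}\left(\frac{b}{\theta}\cdot\frac{S}{I}\le\gamma_n\right)=\frac{1}{\Gamma(m)\Gamma(a)}\,G^{2,1}_{1,3}\left(\begin{matrix}1\\ m,a,0\end{matrix}\,\middle|\,\gamma_n\right),$$ where $$G^{2,1}_{1,3}\left(\begin{matrix}1\\ m,a,0\end{matrix}\,\middle|\,\gamma_n\right)=\frac{\Gamma(a-m)\,\gamma_n^{m}}{m}\,{}_1F_2(m;\,m+1-a,\,m+1;\,\gamma_n)+\frac{\Gamma(m-a)\,\gamma_n^{a}}{a}\,{}_1F_2(a;\,a+1-m,\,a+1;\,\gamma_n).$$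
   Context: $\Gamma(\cdot)$ is the gamma function (extended meromorphically). The Meijer G-function here is, for $x>0$, $$G^{2,1}_{1,3}\left(\begin{matrix}1\\ m,a,0\end{matrix}\,\middle|\,x\right)=\frac{1}{2\pi i}\int_{c-i\infty}^{c+i\infty}\frac{\Gamma(m-s)\,\Gamma(a-s)\,\Gamma(s)}{\Gamma(1+s)}\,x^{s}\,ds,\qquad 0<c<\min(m,a).$$ The generalized hypergeometric function is ${}_1F_2(p;q,r;x)=\sum_{n\ge0}\frac{(p)_n}{(q)_n(r)_n}\frac{x^n}{n!}$ with $(p)_n=p(p+1)\cdots(p+n-1)$. Interpretation: $S$ is the received signal power under Nakagami-$m$ fading (with $\theta$ equal to the mean received power divided by $m$), $I$ is the aggregate interference modelled by an inverse Gamma distribution, and $\frac{b}{\theta}\frac{S}{I}$ is the normalized signal-to-interference ratio.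
   Formalization: The hypergeometric formula for G is proved as an equality when a−m is not an integer; when a−m is an integer its Gamma factors have poles and the formula is undefined, so it is proved there as the limit of the formula as a' tends to a. *)

theory Defs
  imports "HOL-Probability.Probability"
begin

definition gamma_density :: "real \<Rightarrow> real \<Rightarrow> real \<Rightarrow> real" where
  "gamma_density k \<theta> x =
     (if x > 0 then x powr (k - 1) * exp (- x / \<theta>) / (Gamma k * \<theta> powr k) else 0)"

definition hypergeom_1F2 :: "real \<Rightarrow> real \<Rightarrow> real \<Rightarrow> real \<Rightarrow> real" where
  "hypergeom_1F2 p q r x =
     (\<Sum>n. pochhammer p n / (pochhammer q n * pochhammer r n) * (x ^ n / fact n))"

(* G^{2,1}_{1,3}(1; m, a, 0 | x) as the integral along the vertical line Re s = c, parametrised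
   as s = c + i t, ds = i dt.  The abscissa c is kept as an argument instead of being chosen;
   it is meaningful for 0 < c < min m a, where the integral converges absolutely. *)
definition meijer_G_2113 :: "real \<Rightarrow> real \<Rightarrow> real \<Rightarrow> real \<Rightarrow> complex" where
  "meijer_G_2113 c m a x =
     1 / (2 * complex_of_real pi * \<i>) *
     (LBINT t. (let s = Complex c t in
        Gamma (complex_of_real m - s) * Gamma (complex_of_real a - s) * Gamma s / Gamma (1 + s)
        * complex_of_real x powr s) * \<i>)"

(* Every term is well defined only if a - m is not an integer: otherwise one of the Gamma factors
   is at a pole or a lower parameter of 1F2 is a nonpositive integer. *)
definition meijer_G_hypergeom :: "real \<Rightarrow> real \<Rightarrow> real \<Rightarrow> real" where
  "meijer_G_hypergeom m a x =
     Gamma (a - m) * x powr m / m * hypergeom_1F2 m (m + 1 - a) (m + 1) x +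
     Gamma (m - a) * x powr a / a * hypergeom_1F2 a (a + 1 - m) (a + 1) x"

end

theory Submission
  imports Defs "HOL-Complex_Analysis.Complex_Analysis" "HOL-Real_Asymp.Real_Asymp"
begin

text \<open>
  Since \<open>Gamma s / Gamma (1 + s) = 1 / s\<close>, all integrals are of the form
  \<open>(\<Prod>p\<in>P. Gamma (p - s)) * x powr s / s\<close> along \<open>Re s = c\<close>, for \<open>P = {m}\<close> and for
  \<open>P = {m, a}\<close>. The recurrence of Gamma alone makes the integrand decay like \<open>1 / t\<^sup>2\<close>, so
  Stirling's formula is not needed, and moving the line to the right by N gains a factor
  \<open>x ^ N / N!\<close>; hence the integral is the sum of its residues. For \<open>{m}\<close> the residue series is the
  lower incomplete Gamma function, i.e. the distribution function of a Gamma variable; for \<open>{m, a}\<close>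
  with \<open>a - m\<close> not an integer it is the hypergeometric expression. The probability is a mixture of
  incomplete Gamma functions, and inserting the integral for \<open>{m}\<close> and Euler's integral for
  \<open>Gamma (a - s)\<close> turns it into the Meijer integral by an absolutely convergent Fubini argument.
  For integer \<open>a - m\<close> the claim follows because the Meijer integral is continuous in \<open>a\<close>.
\<close>

subsection \<open>Decay of the Gamma function on vertical strips\<close>

text \<open>Euler's integral dominates: the modulus of \<open>t powr (z - 1)\<close> depends only on
  \<open>Re z\<close>.\<close>

lemma norm_Gamma_le:
  fixes z :: complex
  assumes "Re z > 0"
  shows "norm (Gamma z) \<le> Gamma (Re z)"
proof -
  have 1: "((\<lambda>t. of_real t powr (z - 1) / of_real (exp t)) has_integral Gamma z) {0..}"
    by (rule Gamma_integral_complex[OF assms])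
  have 2: "((\<lambda>t. t powr (Re z - 1) / exp t) has_integral Gamma (Re z)) {0..}"
    by (rule Gamma_integral_real[OF assms])
  have "norm (integral {0..} (\<lambda>t. of_real t powr (z - 1) / of_real (exp t) :: complex))
      \<le> integral {0..} (\<lambda>t. t powr (Re z - 1) / exp t)"
    using 1 2 by (intro integral_norm_bound_integral)
      (auto simp: norm_divide norm_powr_real_powr integrable_on_def)
  with 1 2 show ?thesis by (simp add: integral_unique)
qed

text \<open>The recurrence writes \<open>Gamma z\<close> as \<open>Gamma (z + k)\<close> over a
  Pochhammer product. For large \<open>k\<close> the numerator is bounded by real Gamma values on a
  compact interval, and each factor of the denominator has modulus at least
  \<open>\<bar>Im z\<bar>\<close>.\<close>

lemma Gamma_strip_decay:
  fixes A B :: real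
  obtains K where "K \<ge> 0"
    "\<And>z. A \<le> Re z \<Longrightarrow> Re z \<le> B \<Longrightarrow> \<bar>Im z\<bar> \<ge> 1 \<Longrightarrow> norm (Gamma z) \<le> K / \<bar>Im z\<bar>"
proof -
  obtain k0 :: nat where k0: "real k0 \<ge> 1 - A" using real_arch_simple by blast
  \<comment> \<open>The successor guarantees at least one factor in the Pochhammer product, which is
    what produces the decay.\<close>
  define k where "k = Suc k0"
  have k: "A + real k \<ge> 1" using k0 by (simp add: k_def)
  have "bounded (Gamma ` {A + real k..B + real k})"
    using k by (intro compact_imp_bounded compact_continuous_image continuous_on_Gamma)
      (auto elim!: nonpos_Ints_cases)
  then obtain K where K: "\<And>x. x \<in> {A + real k..B + real k} \<Longrightarrow> norm (Gamma x) \<le> K"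
    unfolding bounded_iff by blast
  show thesis
  \<comment> \<open>\<open>K\<close> may be negative if the interval is empty.\<close>
  proof (rule that[of "max K 0"])
    fix z assume z: "A \<le> Re z" "Re z \<le> B" "\<bar>Im z\<bar> \<ge> 1"
    have nz: "z \<notin> \<int>\<^sub>\<le>\<^sub>0" using z by (auto elim!: nonpos_Ints_cases)
    hence "pochhammer z k \<noteq> 0" using pochhammer_eq_0_imp_nonpos_Int by blast
    moreover have "Gamma z * pochhammer z k = Gamma (z + of_nat k)"
      by (simp add: pochhammer_Gamma[OF nz] Gamma_eq_zero_iff nz)
    ultimately have G: "Gamma z = Gamma (z + of_nat k) / pochhammer z k"
      by (simp add: eq_divide_eq)
    have "norm (Gamma (z + of_nat k)) \<le> max K 0"
      using norm_Gamma_le[of "z + of_nat k"] K[of "Re z + real k"] z k by auto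
    moreover have "norm (pochhammer z k) \<ge> \<bar>Im z\<bar>"
    proof -
      have "\<bar>Im z\<bar> ^ k \<le> (\<Prod>i<k. norm (z + of_nat i))"
        using abs_Im_le_cmod[of "z + of_nat _"]
        by (subst card_lessThan[symmetric], subst prod_constant[symmetric], intro prod_mono) auto
      also have "\<dots> = norm (pochhammer z k)"
        by (simp add: pochhammer_prod atLeast0LessThan prod_norm)
      finally have "\<bar>Im z\<bar> ^ k \<le> norm (pochhammer z k)" .
      moreover have "\<bar>Im z\<bar> ^ 1 \<le> \<bar>Im z\<bar> ^ k" using z by (intro power_increasing) (auto simp: k_def)
      ultimately show ?thesis by simp
    qed
    ultimately show "norm (Gamma z) \<le> max K 0 / \<bar>Im z\<bar>"
      unfolding G norm_divide using z by (intro frac_le) auto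
  qed auto
qed

lemma integrable_inverse_square_decay:
  fixes g :: "real \<Rightarrow> complex"
  assumes cont: "continuous_on UNIV g" and bd: "\<And>t. \<bar>t\<bar> \<ge> 1 \<Longrightarrow> norm (g t) \<le> K / t\<^sup>2"
  shows "integrable lborel g"
proof -
  have "bounded (g ` {-1..1})"
    by (intro compact_imp_bounded compact_continuous_image continuous_on_subset[OF cont]) auto
  then obtain L where L: "\<And>x. x \<in> {-1..1} \<Longrightarrow> norm (g x) \<le> L" unfolding bounded_iff by blast
  \<comment> \<open>The factor 2 serves both ranges: \<open>1 + t\<^sup>2\<close> is at most
    \<open>2 * t\<^sup>2\<close> for \<open>\<bar>t\<bar> \<ge> 1\<close> and at most 2
    otherwise.\<close>
  define C where "C = 2 * max \<bar>K\<bar> \<bar>L\<bar>"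
  have C: "norm (g t) \<le> C * inverse (1 + t\<^sup>2)" for t
  proof (cases "\<bar>t\<bar> \<ge> 1")
    case True
    have t: "t\<^sup>2 \<ge> 1" using True by (metis abs_square_le_1 dual_order.refl linorder_not_le nle_le one_le_power power2_abs)
    have "norm (g t) \<le> K / t\<^sup>2" by (rule bd[OF True])
    also have "\<dots> \<le> \<bar>K\<bar> / t\<^sup>2" by (intro divide_right_mono) auto
    also have "\<dots> \<le> \<bar>K\<bar> * (2 * inverse (1 + t\<^sup>2))"
    proof -
      have "inverse (t\<^sup>2) \<le> 2 * inverse (1 + t\<^sup>2)" using t by (simp add: divide_simps)
      thus ?thesis unfolding divide_inverse by (intro mult_left_mono) auto
    qed
    also have "\<dots> \<le> C * inverse (1 + t\<^sup>2)" unfolding C_def mult.assoc[symmetric]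
      by (intro mult_right_mono) (auto simp: add_nonneg_nonneg)
    finally show ?thesis .
  next
    case False
    hence t: "t\<^sup>2 \<le> 1" by (simp add: abs_square_le_1)
    have "t \<in> {-1..1}" using False by auto
    hence "norm (g t) \<le> \<bar>L\<bar>" using L[of t] by linarith
    also have "\<dots> \<le> \<bar>L\<bar> * (2 * inverse (1 + t\<^sup>2))"
    proof -
      have "1 + t\<^sup>2 > 0" by (simp add: add_pos_nonneg)
      hence "1 \<le> 2 * inverse (1 + t\<^sup>2)" using t by (simp add: field_simps)
      from mult_left_mono[OF this, of "\<bar>L\<bar>"] show ?thesis by simp
    qed
    also have "\<dots> \<le> C * inverse (1 + t\<^sup>2)" unfolding C_def mult.assoc[symmetric]
      by (intro mult_right_mono) (auto simp: add_nonneg_nonneg)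
    finally show ?thesis .
  qed
  have "integrable lborel (\<lambda>t::real. inverse (1 + t\<^sup>2))"
    using integrable_inverse_1_plus_square by (simp add: set_integrable_def)
  hence "integrable lborel (\<lambda>t. C * inverse (1 + t\<^sup>2))" by (rule integrable_mult_right)
  thus ?thesis
    by (rule Bochner_Integration.integrable_bound)
       (use C cont in \<open>auto intro!: AE_I2 borel_measurable_continuous_onI intro: order.trans[OF _ abs_ge_self]\<close>)
qed

subsection \<open>Shifting a vertical line of integration\<close>

text \<open>Links the gauge integrals over finite segments, which come from contour integrals, to
  the Lebesgue integral over the whole line.\<close>

lemma tendsto_integral_symmetric_interval:
  fixes g :: "real \<Rightarrow> complex"
  assumes g: "integrable lborel g"
  shows "(\<lambda>n. integral {- real n..real n} g) \<longlonglongrightarrow> (LBINT t. g t)"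
proof -
  have eq: "integral {- real n..real n} g = (LBINT t. indicator {- real n..real n} t *\<^sub>R g t)" for n
  proof -
    have "set_integrable lborel {- real n..real n} g"
      unfolding set_integrable_def using g by (intro integrable_mult_indicator) auto
    from set_borel_integral_eq_integral(2)[OF this] show ?thesis
      by (simp add: set_lebesgue_integral_def)
  qed
  have "(\<lambda>n. LBINT t. indicator {- real n..real n} t *\<^sub>R g t) \<longlonglongrightarrow> (LBINT t. g t)"
  proof (rule integral_dominated_convergence[where w = "\<lambda>t. norm (g t)"])
    show "AE t in lborel. (\<lambda>n. indicator {- real n..real n} t *\<^sub>R g t) \<longlonglongrightarrow> g t"
    proof (intro AE_I2 tendsto_eventually)
      fix t :: real
      obtain N :: nat where N: "\<bar>t\<bar> \<le> real N" using real_arch_simple by blast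
      show "\<forall>\<^sub>F n in sequentially. indicator {- real n..real n} t *\<^sub>R g t = g t"
        using eventually_ge_at_top[of N] by eventually_elim (use N in \<open>auto simp: indicator_def\<close>)
    qed
  qed (use g in \<open>auto intro!: AE_I2 simp: indicator_def\<close>)
  thus ?thesis by (simp add: eq)
qed

text \<open>Residue theorem on rectangles of half-height \<open>n\<close> with vertical sides on the
  two lines. The horizontal sides are of order \<open>1 / n\<^sup>2\<close> by the decay hypothesis.
  The counterclockwise boundary runs up the line at \<open>d\<close> and down the line at
  \<open>c\<close>, hence the minus sign.\<close>

lemma vertical_line_shift:
  fixes f :: "complex \<Rightarrow> complex" and l r c d K :: real and pts :: "complex set"
  assumes lr: "l < c" "c < d" "d < r"
    and fin: "finite pts"
    and hol: "f holomorphic_on {z. l < Re z \<and> Re z < r} - pts"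
    and off: "\<And>p. p \<in> pts \<Longrightarrow> Re p \<noteq> c \<and> Re p \<noteq> d"
    and decay: "\<And>z. c \<le> Re z \<Longrightarrow> Re z \<le> d \<Longrightarrow> \<bar>Im z\<bar> \<ge> 1 \<Longrightarrow> norm (f z) \<le> K / (Im z)\<^sup>2"
  shows "integrable lborel (\<lambda>t. f (Complex c t))"
    and "integrable lborel (\<lambda>t. f (Complex d t))"
    and "(LBINT t. f (Complex c t)) =
           (LBINT t. f (Complex d t)) - 2 * pi * (\<Sum>p\<in>{p \<in> pts. c < Re p \<and> Re p < d}. residue f p)"
proof -
  define S where "S = {z. l < Re z \<and> Re z < r}"
  have S: "open S" "convex S"
  proof -
    have "S = {z. Re z > l} \<inter> {z. Re z < r}" by (auto simp: S_def)
    thus "open S" "convex S"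
      by (auto intro!: open_Int open_halfspace_Re_gt open_halfspace_Re_lt convex_Int
            convex_halfspace_Re_gt convex_halfspace_Re_lt)
  qed
  have cont: "continuous_on (S - pts) f"
    using hol holomorphic_on_imp_continuous_on S_def by blast
  have line: "continuous_on UNIV (\<lambda>t. f (Complex x t))"
    if "l < x" "x < r" "\<And>p. p \<in> pts \<Longrightarrow> Re p \<noteq> x" for x
  proof (rule continuous_on_compose2[OF cont])
    show "continuous_on UNIV (\<lambda>t. Complex x t)" unfolding Complex_eq by (intro continuous_intros)
    show "range (Complex x) \<subseteq> S - pts"
      using that(1,2) that(3)[of "Complex x _"] by (auto simp: S_def)
  qed
  show ic: "integrable lborel (\<lambda>t. f (Complex c t))"
  proof (rule integrable_inverse_square_decay[where K = K])
    show "continuous_on UNIV (\<lambda>t. f (Complex c t))" using lr off by (intro line) auto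
    show "norm (f (Complex c t)) \<le> K / t\<^sup>2" if "\<bar>t\<bar> \<ge> 1" for t
      using decay[of "Complex c t"] lr that by simp
  qed
  show id: "integrable lborel (\<lambda>t. f (Complex d t))"
  proof (rule integrable_inverse_square_decay[where K = K])
    show "continuous_on UNIV (\<lambda>t. f (Complex d t))" using lr off by (intro line) auto
    show "norm (f (Complex d t)) \<le> K / t\<^sup>2" if "\<bar>t\<bar> \<ge> 1" for t
      using decay[of "Complex d t"] lr that by simp
  qed
  define R where "R = (\<Sum>p\<in>{p \<in> pts. c < Re p \<and> Re p < d}. residue f p)"
  \<comment> \<open>The contribution of the two horizontal sides.\<close>
  define h where "h = (\<lambda>n::nat. contour_integral (linepath (Complex c (-n)) (Complex d (-n))) f
                     + contour_integral (linepath (Complex d n) (Complex c n)) f)"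
  \<comment> \<open>Beyond height \<open>N0\<close> no pole meets a horizontal side, and every pole
    between the lines is enclosed.\<close>
  obtain N0 :: nat where N0: "\<And>p. p \<in> pts \<Longrightarrow> \<bar>Im p\<bar> \<le> real N0"
  proof -
    have "bounded (Im ` pts)" using fin by (intro finite_imp_bounded) auto
    then obtain B where "\<And>p. p \<in> pts \<Longrightarrow> \<bar>Im p\<bar> \<le> B" unfolding bounded_iff by auto
    thus ?thesis using that real_arch_simple[of B] by (meson order.trans)
  qed
  have rect: "\<i> * (integral {-real n..real n} (\<lambda>t. f (Complex d t))
               - integral {-real n..real n} (\<lambda>t. f (Complex c t))) + h n = 2 * pi * \<i> * R"
    and h_le: "norm (h n) \<le> 2 * (K / (real n)\<^sup>2 * (d - c))" if n: "n > N0" for n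
  proof -
    define p q where "p = Complex c (- real n)" and "q = Complex d (real n)"
    have n0: "real n > 0" "real n \<ge> 1" using n by auto
    have le: "Re p \<le> Re q" "Im p \<le> Im q" using lr by (auto simp: p_def q_def)
    have img: "path_image (rectpath p q) \<subseteq> S - pts"
    proof -
      have "z \<notin> pts" if "z \<in> path_image (rectpath p q)" for z
        using that off[of z] N0[of z] n unfolding path_image_rectpath[OF le] by (auto simp: p_def q_def)
      moreover have "path_image (rectpath p q) \<subseteq> S"
        using lr unfolding path_image_rectpath[OF le] by (auto simp: p_def q_def S_def)
      ultimately show ?thesis by blast
    qed
    have sides: "path_image (linepath p (Complex d (-real n))) \<subseteq> path_image (rectpath p q)"
      "path_image (linepath (Complex d (-real n)) q) \<subseteq> path_image (rectpath p q)"
      "path_image (linepath q (Complex c n)) \<subseteq> path_image (rectpath p q)"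
      "path_image (linepath (Complex c n) p) \<subseteq> path_image (rectpath p q)"
      by (auto simp: rectpath_def Let_def path_image_join p_def q_def)
    have ci: "f contour_integrable_on linepath p (Complex d (-real n))"
      "f contour_integrable_on linepath (Complex d (-real n)) q"
      "f contour_integrable_on linepath q (Complex c n)"
      "f contour_integrable_on linepath (Complex c n) p"
      using sides img by (auto intro!: contour_integrable_continuous_linepath continuous_on_subset[OF cont])
    have "contour_integral (rectpath p q) f = 2 * pi * \<i> * (\<Sum>z\<in>pts. winding_number (rectpath p q) z * residue f z)"
    proof (rule Residue_theorem)
      show "\<forall>z. z \<notin> S \<longrightarrow> winding_number (rectpath p q) z = 0"
        using lr le by (auto intro!: winding_number_rectpath_outside simp: S_def in_cbox_complex_iff p_def q_def)
    qed (use S fin hol img in \<open>auto simp: S_def[symmetric] intro: convex_connected\<close>)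
    also have "(\<Sum>z\<in>pts. winding_number (rectpath p q) z * residue f z) =
       (\<Sum>z\<in>pts. if c < Re z \<and> Re z < d then residue f z else 0)"
    proof (rule sum.cong[OF refl])
      fix z assume z: "z \<in> pts"
      have "z \<in> box p q \<longleftrightarrow> c < Re z \<and> Re z < d" "z \<notin> box p q \<longleftrightarrow> z \<notin> cbox p q"
        using N0[OF z] n off[OF z] by (auto simp: in_box_complex_iff in_cbox_complex_iff p_def q_def)
      thus "winding_number (rectpath p q) z * residue f z = (if c < Re z \<and> Re z < d then residue f z else 0)"
        using winding_number_rectpath[of z p q] winding_number_rectpath_outside[OF le, of z] by auto
    qed
    also have "\<dots> = R" unfolding R_def using fin by (simp add: sum.If_cases sum.inter_filter)
    also have "contour_integral (rectpath p q) f =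
       contour_integral (linepath p (Complex d (-real n))) f
       + contour_integral (linepath (Complex d (-real n)) q) f
       + contour_integral (linepath q (Complex c n)) f
       + contour_integral (linepath (Complex c n) p) f"
      using ci by (simp add: rectpath_def Let_def p_def q_def)
    also have "contour_integral (linepath (Complex c n) p) f = - contour_integral (linepath p (Complex c n)) f"
      by (metis contour_integral_reversepath reversepath_linepath valid_path_linepath)
    also have "contour_integral (linepath p (Complex c n)) f = \<i> * integral {-real n..real n} (\<lambda>t. f (Complex c t))"
      using n0 by (intro contour_integral_linepath_same_Re) (auto simp: p_def)
    also have "contour_integral (linepath (Complex d (-real n)) q) f = \<i> * integral {-real n..real n} (\<lambda>t. f (Complex d t))"
      using n0 by (intro contour_integral_linepath_same_Re) (auto simp: q_def)
    finally show "\<i> * (integral {-real n..real n} (\<lambda>t. f (Complex d t))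
               - integral {-real n..real n} (\<lambda>t. f (Complex c t))) + h n = 2 * pi * \<i> * R"
      unfolding h_def p_def q_def by (simp add: algebra_simps)
    have K: "0 \<le> K / (real n)\<^sup>2" using decay[of "Complex c n"] lr n0 by (auto intro: order.trans[OF norm_ge_zero])
    have dist: "norm (Complex d x - Complex c x) = d - c" "norm (Complex c x - Complex d x) = d - c" for x
      using lr by (auto simp: cmod_def)
    have "norm (contour_integral (linepath p (Complex d (-real n))) f) \<le> K / (real n)\<^sup>2 * norm (Complex d (- real n) - p)"
    proof (rule contour_integral_bound_linepath[OF ci(1) K])
      fix z assume "z \<in> closed_segment p (Complex d (- real n))"
      thus "norm (f z) \<le> K / (real n)\<^sup>2" using decay[of z] n0 lr
        by (auto simp: p_def closed_segment_same_Im closed_segment_eq_real_ivl)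
    qed
    moreover have "norm (contour_integral (linepath q (Complex c n)) f) \<le> K / (real n)\<^sup>2 * norm (Complex c n - q)"
    proof (rule contour_integral_bound_linepath[OF ci(3) K])
      fix z assume "z \<in> closed_segment q (Complex c n)"
      thus "norm (f z) \<le> K / (real n)\<^sup>2" using decay[of z] n0 lr
        by (auto simp: q_def closed_segment_same_Im closed_segment_eq_real_ivl)
    qed
    ultimately show "norm (h n) \<le> 2 * (K / (real n)\<^sup>2 * (d - c))"
      unfolding h_def p_def q_def dist by (intro order.trans[OF norm_triangle_ineq]) simp
  qed
  have h0: "h \<longlonglongrightarrow> 0"
  proof (rule Lim_null_comparison)
    show "\<forall>\<^sub>F n in sequentially. norm (h n) \<le> 2 * (K / (real n)\<^sup>2 * (d - c))"
      using eventually_gt_at_top[of N0] by eventually_elim (rule h_le)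
    show "(\<lambda>n. 2 * (K / (real n)\<^sup>2 * (d - c))) \<longlonglongrightarrow> 0" by real_asymp
  qed
  have "(\<lambda>n. \<i> * (integral {-real n..real n} (\<lambda>t. f (Complex d t))
               - integral {-real n..real n} (\<lambda>t. f (Complex c t))) + h n)
     \<longlonglongrightarrow> \<i> * ((LBINT t. f (Complex d t)) - (LBINT t. f (Complex c t))) + 0"
    by (intro tendsto_intros h0 tendsto_integral_symmetric_interval ic id)
  moreover have "\<forall>\<^sub>F n in sequentially. \<i> * (integral {-real n..real n} (\<lambda>t. f (Complex d t))
               - integral {-real n..real n} (\<lambda>t. f (Complex c t))) + h n = 2 * pi * \<i> * R"
    using eventually_gt_at_top[of N0] by eventually_elim (rule rect)
  ultimately have "\<i> * ((LBINT t. f (Complex d t)) - (LBINT t. f (Complex c t))) + 0 = 2 * pi * \<i> * R"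
    by (intro LIMSEQ_unique[OF _ tendsto_eventually])
  \<comment> \<open>The factor from \<open>ds = \<i> dt\<close> cancels against the one in the
    residue theorem.\<close>
  hence "\<i> * ((LBINT t. f (Complex d t)) - (LBINT t. f (Complex c t))) = \<i> * (2 * pi * R)" by simp
  hence "(LBINT t. f (Complex d t)) - (LBINT t. f (Complex c t)) = 2 * pi * R"
    using mult_cancel_left complex_i_not_zero by blast
  thus "(LBINT t. f (Complex c t)) = (LBINT t. f (Complex d t)) - 2 * pi * (\<Sum>p\<in>{p \<in> pts. c < Re p \<and> Re p < d}. residue f p)"
    unfolding R_def by (simp add: algebra_simps)
qed

subsection \<open>Mellin-Barnes integrals as residue series\<close>

definition barnes_integrand :: "real set \<Rightarrow> real \<Rightarrow> complex \<Rightarrow> complex" where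
  "barnes_integrand P x s = (\<Prod>p\<in>P. Gamma (of_real p - s)) * of_real x powr s / s"

text \<open>
  The value at \<open>n\<close> is minus the residue of the integrand at its pole \<open>p + n\<close>; the sign matches closing
  the contour to the right.
\<close>
definition barnes_term :: "real set \<Rightarrow> real \<Rightarrow> real \<Rightarrow> nat \<Rightarrow> real" where
  "barnes_term P x p n =
     (-1) ^ n / fact n * (\<Prod>q\<in>P - {p}. Gamma (q - p - real n)) * x powr (p + real n) / (p + real n)"

text \<open>The condition \<open>nonint\<close> keeps the pole sequences \<open>p + n\<close> of
  different \<open>p\<close> disjoint, so that every pole in the right half-plane is simple.\<close>

locale barnes =
  fixes P :: "real set" and x :: real
  assumes fin: "finite P" and ne: "P \<noteq> {}" and pos: "p \<in> P \<Longrightarrow> p > 0"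
    and nonint: "p \<in> P \<Longrightarrow> q \<in> P \<Longrightarrow> p \<noteq> q \<Longrightarrow> p - q \<notin> \<int>" and x: "x > 0"
begin

text \<open>Indexing by pairs lets the sum of residues split into one series per \<open>p\<close>.
  The cut-off at \<open>r\<close> leaves finitely many poles, as \<open>vertical_line_shift\<close>
  demands.\<close>

definition pole_indices :: "real \<Rightarrow> (real \<times> nat) set" where "pole_indices r = {(p, n). p \<in> P \<and> p + real n < r}"
definition pole :: "real \<times> nat \<Rightarrow> complex" where "pole = (\<lambda>(p, n). of_real (p + real n))"

lemma finite_pole_indices: "finite (pole_indices r)"
proof (rule finite_subset)
  show "pole_indices r \<subseteq> P \<times> {..<nat \<lceil>r\<rceil>}" using pos by (force simp: pole_indices_def less_ceiling_iff zless_nat_eq_int_zless)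
qed (use fin in auto)

lemma inj_pole: "inj_on pole (pole_indices r)"
proof (rule inj_onI, clarify)
  fix p q :: real and i j :: nat
  assume *: "(p, i) \<in> pole_indices r" "(q, j) \<in> pole_indices r" "pole (p, i) = pole (q, j)"
  from *(3) have "complex_of_real (p + real i) = complex_of_real (q + real j)"
    unfolding pole_def by simp
  hence eq: "p + real i = q + real j" by (simp only: of_real_eq_iff)
  hence "p - q = real_of_int (int j - int i)" by simp
  hence "p - q \<in> \<int>" by (metis Ints_of_int)
  with * nonint have "p = q" by (auto simp: pole_indices_def)
  with eq show "p = q \<and> i = j" by simp
qed

lemma arg_nonpos_Int:
  assumes "p \<in> P" "of_real p - s \<in> \<int>\<^sub>\<le>\<^sub>0" "Re s < r"
  shows "s \<in> pole ` pole_indices r"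
proof -
  from assms(2) obtain n where "of_real p - s = - of_nat n" by (auto elim!: nonpos_Ints_cases')
  hence "s = of_real (p + real n)" by (simp add: algebra_simps)
  thus ?thesis using assms by (auto simp: pole_def pole_indices_def intro!: image_eqI[of _ _ "(p, n)"])
qed

lemma holomorphic_barnes:
  "barnes_integrand P x holomorphic_on {z. 0 < Re z \<and> Re z < r} - pole ` pole_indices r"
proof -
  \<comment> \<open>For \<open>x > 0\<close> the power is \<open>exp (s * ln x)\<close>, which is
    visibly entire in \<open>s\<close>.\<close>
  have "(\<lambda>s. (\<Prod>p\<in>P. Gamma (of_real p - s)) * exp (s * of_real (ln x)) / s)
          holomorphic_on {z. 0 < Re z \<and> Re z < r} - pole ` pole_indices r"
    using arg_nonpos_Int by (intro holomorphic_intros) auto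
  thus ?thesis
    using x by (simp add: barnes_integrand_def[abs_def] powr_def Ln_of_real)
qed

text \<open>One factor \<open>1 / \<bar>Im z\<bar>\<close> comes from \<open>1 / s\<close>, the
  other from a single Gamma factor. Further Gamma factors only contribute more powers of
  \<open>1 / \<bar>Im z\<bar> \<le> 1\<close>.\<close>

lemma barnes_decay:
  assumes "0 < c" "c \<le> d"
  obtains K where "\<And>z. c \<le> Re z \<Longrightarrow> Re z \<le> d \<Longrightarrow> \<bar>Im z\<bar> \<ge> 1 \<Longrightarrow>
    norm (barnes_integrand P x z) \<le> K / (Im z)\<^sup>2"
proof -
  have "\<exists>K\<ge>0. \<forall>z. p - d \<le> Re z \<longrightarrow> Re z \<le> p - c \<longrightarrow> \<bar>Im z\<bar> \<ge> 1 \<longrightarrow> norm (Gamma z) \<le> K / \<bar>Im z\<bar>" for p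
    using Gamma_strip_decay[of "p - d" "p - c"] by metis
  then obtain K where K0: "\<And>p. K p \<ge> 0"
    and K: "\<And>p z. p - d \<le> Re z \<Longrightarrow> Re z \<le> p - c \<Longrightarrow> \<bar>Im z\<bar> \<ge> 1 \<Longrightarrow> norm (Gamma z) \<le> K p / \<bar>Im z\<bar>"
    by metis
  show thesis
  proof (rule that[of "(\<Prod>p\<in>P. K p) * (x powr c + x powr d)"])
    fix z assume z: "c \<le> Re z" "Re z \<le> d" "\<bar>Im z\<bar> \<ge> 1"
    have "norm (\<Prod>p\<in>P. Gamma (of_real p - z)) \<le> (\<Prod>p\<in>P. K p / \<bar>Im z\<bar>)"
      unfolding prod_norm[symmetric]
    proof (intro prod_mono conjI norm_ge_zero)
      fix p show "norm (Gamma (of_real p - z)) \<le> K p / \<bar>Im z\<bar>"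
        using K[of p "of_real p - z"] z by simp
    qed
    also have "\<dots> = (\<Prod>p\<in>P. K p) / \<bar>Im z\<bar> ^ card P" by (simp add: prod_dividef)
    also have "\<dots> \<le> (\<Prod>p\<in>P. K p) / \<bar>Im z\<bar> ^ 1"
    proof (rule divide_left_mono)
      have "card P \<ge> 1" using fin ne by (simp add: Suc_le_eq card_gt_0_iff)
      thus "\<bar>Im z\<bar> ^ 1 \<le> \<bar>Im z\<bar> ^ card P" using z by (intro power_increasing) auto
    qed (use K0 z in \<open>auto intro!: prod_nonneg\<close>)
    finally have 1: "norm (\<Prod>p\<in>P. Gamma (of_real p - z)) \<le> (\<Prod>p\<in>P. K p) / \<bar>Im z\<bar>" by simp
    \<comment> \<open>The modulus is monotone in \<open>Re z\<close>, in a direction depending on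
      whether \<open>x \<ge> 1\<close>; the sum of both end values covers both cases.\<close>
    have 2: "norm (complex_of_real x powr z) \<le> x powr c + x powr d"
    proof -
      have "norm (complex_of_real x powr z) = x powr Re z"
        using x by (simp add: norm_powr_real_powr)
      also have "\<dots> \<le> x powr c + x powr d"
      proof (cases "x \<ge> 1")
        case True
        hence "x powr Re z \<le> x powr d" using z by (intro powr_mono) auto
        thus ?thesis by (simp add: add_increasing)
      next
        case False
        hence "x powr Re z \<le> x powr c" using z x by (intro powr_mono') auto
        thus ?thesis by (simp add: add_increasing2)
      qed
      finally show ?thesis .
    qed
    have 3: "norm (barnes_integrand P x z) \<le>
        (\<Prod>p\<in>P. K p) / \<bar>Im z\<bar> * (x powr c + x powr d) / \<bar>Im z\<bar>"
      unfolding barnes_integrand_def norm_mult norm_divide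
      using 1 2 z abs_Im_le_cmod[of z]
      by (intro frac_le mult_mono) (auto intro!: mult_nonneg_nonneg divide_nonneg_nonneg prod_nonneg K0)
    show "norm (barnes_integrand P x z) \<le> (\<Prod>p\<in>P. K p) * (x powr c + x powr d) / (Im z)\<^sup>2"
      by (rule order.trans[OF 3]) (simp add: power2_eq_square)
  qed
qed

text \<open>Only \<open>Gamma (p - s)\<close> is singular at \<open>p + n\<close>. It contributes
  the known residue of Gamma at \<open>-n\<close>, with reversed sign because the argument runs
  backwards; the remaining factors are evaluated at the pole.\<close>

lemma residue_barnes:
  assumes "(p, n) \<in> pole_indices r"
  shows "residue (barnes_integrand P x) (pole (p, n)) = - of_real (barnes_term P x p n)"
proof -
  have p: "p \<in> P" and pr: "p + real n < r" using assms by (auto simp: pole_indices_def)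
  define z where "z = pole (p, n)"
  have z: "z = of_real (p + real n)" by (simp add: z_def pole_def)
  have pn: "p + real n > 0" using pos[OF p] by simp
  \<comment> \<open>All other poles are removed, so \<open>z\<close> is the only singularity in
    \<open>U\<close>.\<close>
  define U where "U = {z. 0 < Re z \<and> Re z < r} - (pole ` pole_indices r - {z})"
  have "open {z. 0 < Re z \<and> Re z < r}"
  proof -
    have "{z. 0 < Re z \<and> Re z < r} = {z. Re z > 0} \<inter> {z. Re z < r}" by auto
    thus ?thesis by (auto intro!: open_Int open_halfspace_Re_gt open_halfspace_Re_lt)
  qed
  hence U: "open U" "z \<in> U" unfolding U_def using pn pr
    by (auto intro!: open_Diff finite_imp_closed finite_pole_indices simp: z)
  have hol: "barnes_integrand P x holomorphic_on (U - {z})"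
    by (rule holomorphic_on_subset[OF holomorphic_barnes[of r]]) (auto simp: U_def)
  have "((\<lambda>w. Gamma w * (w + of_nat n)) \<longlongrightarrow> (-1) ^ n / fact n) (at (- of_nat n :: complex))"
    by (rule Gamma_residues)
  moreover have "filterlim (\<lambda>w. of_real p - w) (at (- of_nat n)) (at z)"
    unfolding filterlim_at
  proof
    show "\<forall>\<^sub>F w in at z. of_real p - w \<in> UNIV \<and> of_real p - w \<noteq> - of_nat n"
      unfolding eventually_at_filter by (intro always_eventually) (auto simp: z algebra_simps)
  qed (auto simp: z intro!: tendsto_eq_intros)
  ultimately have "((\<lambda>w. Gamma (of_real p - w) * (of_real p - w + of_nat n)) \<longlongrightarrow> (-1) ^ n / fact n) (at z)"
    by (rule filterlim_compose)
  \<comment> \<open>Here \<open>p - w + n = - (w - z)\<close>, which is the source of the minus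
    sign.\<close>
  hence 1: "((\<lambda>w. Gamma (of_real p - w) * (w - z)) \<longlongrightarrow> - ((-1) ^ n / fact n)) (at z)"
    by (drule_tac tendsto_minus) (simp add: z algebra_simps)
  have 2: "((\<lambda>w. (\<Prod>q\<in>P - {p}. Gamma (of_real q - w)) * exp (w * of_real (ln x)) / w) \<longlongrightarrow>
      (\<Prod>q\<in>P - {p}. Gamma (of_real q - z)) * exp (z * of_real (ln x)) / z) (at z)"
  proof (intro tendsto_intros)
    fix q assume q: "q \<in> P - {p}"
    show "of_real q - z \<notin> \<int>\<^sub>\<le>\<^sub>0"
    proof
      assume "of_real q - z \<in> \<int>\<^sub>\<le>\<^sub>0"
      then obtain m where "of_real q - z = - complex_of_nat m" by (auto elim!: nonpos_Ints_cases')
      hence "complex_of_real q - complex_of_real p = of_real (real n - real m)"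
        by (simp add: z algebra_simps)
      hence "q - p = real n - real m"
        by (simp only: of_real_diff[symmetric] of_real_eq_iff)
      hence "q - p \<in> \<int>" by simp
      thus False using nonint[of q p] q p by auto
    qed
  next
    show "z \<noteq> 0" using pn by (simp only: z of_real_eq_0_iff)
  qed
  have lim: "((\<lambda>w. barnes_integrand P x w * (w - z)) \<longlongrightarrow>
     - ((-1) ^ n / fact n) * ((\<Prod>q\<in>P - {p}. Gamma (of_real q - z)) * exp (z * of_real (ln x)) / z)) (at z)"
    using tendsto_mult[OF 1 2] x
    by (simp add: barnes_integrand_def prod.remove[OF fin p] powr_def Ln_of_real mult_ac)
  have "residue (barnes_integrand P x) z =
    - ((-1) ^ n / fact n) * ((\<Prod>q\<in>P - {p}. Gamma (of_real q - z)) * exp (z * of_real (ln x)) / z)"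
    by (rule residue_simple'[OF U hol lim])
  also have "(\<Prod>q\<in>P - {p}. Gamma (of_real q - z)) = of_real (\<Prod>q\<in>P - {p}. Gamma (q - p - real n))"
    unfolding of_real_prod
  proof (rule prod.cong[OF refl])
    fix q
    have "of_real q - z = complex_of_real (q - p - real n)" by (simp add: z)
    show "Gamma (of_real q - z) = complex_of_real (Gamma (q - p - real n))"
      by (simp only: \<open>of_real q - z = _\<close> Gamma_complex_of_real)
  qed
  also have "exp (z * of_real (ln x)) = of_real (x powr (p + real n))"
  proof -
    have "z * of_real (ln x) = of_real ((p + real n) * ln x)" by (simp add: z)
    thus ?thesis using x by (simp only: exp_of_real powr_def if_False less_imp_neq[symmetric])
  qed
  finally show ?thesis unfolding z_def[symmetric] barnes_term_def by (simp add: z)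
qed

lemma line_shift:
  assumes c: "0 < c" "\<And>p. p \<in> P \<Longrightarrow> c < p" and d: "c < d" "\<And>p. p \<in> P \<Longrightarrow> p - d \<notin> \<int>"
  shows "integrable lborel (\<lambda>t. barnes_integrand P x (Complex c t))"
    and "integrable lborel (\<lambda>t. barnes_integrand P x (Complex d t))"
    and "(LBINT t. barnes_integrand P x (Complex c t)) =
           (LBINT t. barnes_integrand P x (Complex d t))
           + 2 * pi * (\<Sum>p\<in>P. \<Sum>n | p + real n < d. of_real (barnes_term P x p n))"
proof -
  obtain K where K: "\<And>z. c \<le> Re z \<Longrightarrow> Re z \<le> d \<Longrightarrow> \<bar>Im z\<bar> \<ge> 1 \<Longrightarrow>
    norm (barnes_integrand P x z) \<le> K / (Im z)\<^sup>2"
    using barnes_decay[of c d] c d by auto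
  have off: "Re z \<noteq> c \<and> Re z \<noteq> d" if z: "z \<in> pole ` pole_indices (d + 1)" for z
  proof -
    from z obtain p n where pn: "p \<in> P" "z = of_real (p + real n)" by (auto simp: pole_indices_def pole_def)
    hence "Re z \<noteq> c" using c(2)[of p] by simp
    moreover have "Re z \<noteq> d"
    proof
      assume "Re z = d"
      hence "p - d = - real n" using pn by simp
      hence "p - d \<in> \<int>" by simp
      thus False using d(2)[OF pn(1)] by simp
    qed
    ultimately show ?thesis by simp
  qed
  \<comment> \<open>The strip ends at \<open>d + 1\<close> merely to contain the line at
    \<open>d\<close> in its interior; poles beyond \<open>d\<close> are removed from the domain but
    not encircled.\<close>
  note shift = vertical_line_shift[of 0 c d "d + 1", OF c(1) d(1) _ _ holomorphic_barnes off K]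
  show "integrable lborel (\<lambda>t. barnes_integrand P x (Complex c t))"
    and "integrable lborel (\<lambda>t. barnes_integrand P x (Complex d t))"
    by (rule shift; simp add: finite_pole_indices)+
  \<comment> \<open>Since \<open>c\<close> lies to the left of all of \<open>P\<close>, every pole
    left of \<open>d\<close> lies between the lines.\<close>
  have "{z \<in> pole ` pole_indices (d + 1). c < Re z \<and> Re z < d} = pole ` pole_indices d"
    using c(2) by (force simp: pole_def pole_indices_def)
  hence "(\<Sum>z\<in>{z \<in> pole ` pole_indices (d + 1). c < Re z \<and> Re z < d}. residue (barnes_integrand P x) z)
      = (\<Sum>i\<in>pole_indices d. residue (barnes_integrand P x) (pole i))"
    by (simp add: sum.reindex[OF inj_pole])
  also have "\<dots> = (\<Sum>i\<in>pole_indices d. - of_real (barnes_term P x (fst i) (snd i)))"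
  proof (rule sum.cong[OF refl])
    fix i assume "i \<in> pole_indices d"
    thus "residue (barnes_integrand P x) (pole i) = - of_real (barnes_term P x (fst i) (snd i))"
      using residue_barnes[of "fst i" "snd i" d] by simp
  qed
  also have "pole_indices d = (SIGMA p:P. {n. p + real n < d})" by (auto simp: pole_indices_def)
  also have "(\<Sum>i\<in>(SIGMA p:P. {n. p + real n < d}). - complex_of_real (barnes_term P x (fst i) (snd i)))
      = (\<Sum>p\<in>P. \<Sum>n | p + real n < d. - of_real (barnes_term P x p n))"
  proof (subst sum.Sigma)
    show "\<forall>p\<in>P. finite {n. p + real n < d}"
    proof
      fix p assume "p \<in> P"
      hence "{n. p + real n < d} = snd ` (pole_indices d \<inter> {p} \<times> UNIV)" by (force simp: pole_indices_def image_def)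
      thus "finite {n. p + real n < d}" using finite_pole_indices by simp
    qed
  qed (use fin in \<open>auto simp: case_prod_unfold\<close>)
  finally have *: "(\<Sum>z\<in>{z \<in> pole ` pole_indices (d + 1). c < Re z \<and> Re z < d}. residue (barnes_integrand P x) z)
    = - (\<Sum>p\<in>P. \<Sum>n | p + real n < d. of_real (barnes_term P x p n))" by (simp add: sum_negf)
  have "(LBINT t. barnes_integrand P x (Complex c t)) =
           (LBINT t. barnes_integrand P x (Complex d t)) - 2 * pi *
     (\<Sum>z\<in>{z \<in> pole ` pole_indices (d + 1). c < Re z \<and> Re z < d}. residue (barnes_integrand P x) z)"
    by (rule shift; simp add: finite_pole_indices)
  thus "(LBINT t. barnes_integrand P x (Complex c t)) =
           (LBINT t. barnes_integrand P x (Complex d t))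
           + 2 * pi * (\<Sum>p\<in>P. \<Sum>n | p + real n < d. of_real (barnes_term P x p n))"
    unfolding * by simp
qed

end

text \<open>By the recurrence, \<open>Gamma w / Gamma (w - N)\<close> is a product of
  \<open>N\<close> factors. As \<open>Re w < 0\<close>, the factor with index \<open>i\<close> has
  modulus at least \<open>N - i\<close>, and these lower bounds multiply to
  \<open>N!\<close>.\<close>

lemma norm_Gamma_shift_left:
  fixes w :: complex
  assumes "Re w < 0" "Re w \<notin> \<int>"
  shows "norm (Gamma (w - of_nat N)) \<le> norm (Gamma w) / fact N"
proof -
  have nint: "w - of_nat k \<notin> \<int>\<^sub>\<le>\<^sub>0" for k
  proof
    assume "w - of_nat k \<in> \<int>\<^sub>\<le>\<^sub>0"
    then obtain j where "w - of_nat k = - of_nat j" by (auto elim!: nonpos_Ints_cases')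
    hence "Re (w - of_nat k) = Re (- of_nat j)" by simp
    hence "Re w = real k - real j" by simp
    thus False using assms(2) by simp
  qed
  have "fact N = (\<Prod>i=0..<N. real (N - i))" by (simp add: fact_prod_rev)
  also have "\<dots> \<le> (\<Prod>i=0..<N. norm (w - of_nat N + of_nat i))"
  proof (intro prod_mono conjI)
    fix i assume i: "i \<in> {0..<N}"
    have "real (N - i) \<le> \<bar>Re (w - of_nat N + of_nat i)\<bar>" using i assms(1) by simp
    also have "\<dots> \<le> norm (w - of_nat N + of_nat i)" by (rule abs_Re_le_cmod)
    finally show "real (N - i) \<le> norm (w - of_nat N + of_nat i)" .
  qed simp
  also have "\<dots> = norm (pochhammer (w - of_nat N) N)"
    by (simp add: pochhammer_prod prod_norm)
  also have "\<dots> = norm (Gamma w) / norm (Gamma (w - of_nat N))"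
    using pochhammer_Gamma[OF nint[of N], of N] by (simp add: norm_divide)
  finally have "fact N \<le> norm (Gamma w) / norm (Gamma (w - of_nat N))" .
  moreover have "norm (Gamma (w - of_nat N)) > 0" using nint[of N] by (simp add: Gamma_eq_zero_iff)
  ultimately show ?thesis by (simp add: field_simps)
qed

context barnes begin

text \<open>Every Gamma factor gains \<open>1 / N!\<close>, of which one is kept; the power of
  \<open>x\<close> gains \<open>x ^ N\<close>, and \<open>1 / norm s\<close> decreases because
  \<open>D > 0\<close>.\<close>

lemma norm_barnes_shift_right:
  assumes D: "\<And>p. p \<in> P \<Longrightarrow> p < D \<and> p - D \<notin> \<int>"
  shows "norm (barnes_integrand P x (Complex (D + real N) t)) \<le>
    x ^ N / fact N * norm (barnes_integrand P x (Complex D t))"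
proof -
  define s where "s = Complex D t"
  have s: "Complex (D + real N) t = s + of_nat N" by (simp add: s_def complex_eq_iff)
  have D0: "D > 0" using ne D pos by force
  have "norm (\<Prod>p\<in>P. Gamma (of_real p - (s + of_nat N))) \<le> (\<Prod>p\<in>P. norm (Gamma (of_real p - s)) / fact N)"
    unfolding prod_norm[symmetric]
  proof (intro prod_mono conjI norm_ge_zero)
    fix p assume "p \<in> P"
    thus "norm (Gamma (of_real p - (s + of_nat N))) \<le> norm (Gamma (of_real p - s)) / fact N"
      using norm_Gamma_shift_left[of "of_real p - s" N] D[of p] by (simp add: s_def diff_diff_eq)
  qed
  also have "\<dots> = (\<Prod>p\<in>P. norm (Gamma (of_real p - s))) / fact N ^ card P"
    by (simp add: prod_dividef)
  also have "\<dots> \<le> (\<Prod>p\<in>P. norm (Gamma (of_real p - s))) / fact N ^ 1"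
  proof (rule divide_left_mono)
    have "card P \<ge> 1" using fin ne by (simp add: Suc_le_eq card_gt_0_iff)
    thus "fact N ^ 1 \<le> (fact N ^ card P :: real)" by (intro power_increasing) auto
  qed (auto intro!: prod_nonneg)
  finally have 1: "norm (\<Prod>p\<in>P. Gamma (of_real p - (s + of_nat N)))
      \<le> norm (\<Prod>p\<in>P. Gamma (of_real p - s)) / fact N" by (simp add: prod_norm)
  have 2: "norm (complex_of_real x powr (s + of_nat N)) = x ^ N * norm (complex_of_real x powr s)"
    using x by (simp add: powr_add norm_mult norm_power norm_powr_real_powr)
  have 3: "norm s \<le> norm (s + of_nat N)"
    using D0 by (simp add: s_def cmod_def)
  have "s \<noteq> 0" using D0 by (auto simp: s_def complex_eq_iff)
  hence "norm (barnes_integrand P x (s + of_nat N)) \<le>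
    norm (\<Prod>p\<in>P. Gamma (of_real p - s)) / fact N * (x ^ N * norm (complex_of_real x powr s)) / norm s"
    unfolding barnes_integrand_def norm_mult norm_divide 2 using 1 3 x
    by (intro frac_le mult_right_mono) auto
  thus ?thesis unfolding s unfolding s_def[symmetric]
    by (simp add: barnes_integrand_def norm_mult norm_divide mult_ac)
qed

lemma Mellin_Barnes_sum:
  assumes c: "0 < c" "\<And>p. p \<in> P \<Longrightarrow> c < p"
    and summable: "\<And>p. p \<in> P \<Longrightarrow> summable (barnes_term P x p)"
  shows "integrable lborel (\<lambda>t. barnes_integrand P x (Complex c t))"
    and "(LBINT t. barnes_integrand P x (Complex c t)) =
           of_real (2 * pi * (\<Sum>p\<in>P. \<Sum>n. barnes_term P x p n))"
proof -
  \<comment> \<open>On the lines \<open>Re s = D + N\<close> the integral tends to 0, provided that \<open>D\<close> lies to the right of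
     \<open>P\<close> and that no such line meets a pole.\<close>
  define M where "M = Max P"
  \<comment> \<open>A counting argument: an open interval is uncountable, while only countably many
    points differ from an element of the finite set \<open>P\<close> by an integer.\<close>
  have "countable (\<Union>p\<in>P. range (\<lambda>k::int. p - of_int k))"
    using fin by (intro countable_UN) (auto intro: countable_finite)
  hence "uncountable ({M<..<M+1} - (\<Union>p\<in>P. range (\<lambda>k::int. p - of_int k)))"
    by (intro uncountable_minus_countable) (auto simp: uncountable_open_interval)
  then obtain D where "D \<in> {M<..<M+1} - (\<Union>p\<in>P. range (\<lambda>k::int. p - of_int k))"
    by (metis all_not_in_conv countable_empty)
  hence D: "D > M" "\<And>p k. p \<in> P \<Longrightarrow> D \<noteq> p - of_int k" by auto
  have PD: "p < D \<and> p - D \<notin> \<int>" if p: "p \<in> P" for p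
  proof
    show "p < D" using D(1) Max_ge[OF fin p] by (simp add: M_def)
    show "p - D \<notin> \<int>"
    proof
      assume "p - D \<in> \<int>"
      then obtain k where "p - D = of_int k" by (auto elim: Ints_cases)
      hence "D = p - of_int k" by simp
      thus False using D(2)[OF p] by blast
    qed
  qed
  have PDN: "p - (D + real N) \<notin> \<int>" if "p \<in> P" for p N
  proof
    assume "p - (D + real N) \<in> \<int>"
    hence "p - (D + real N) + real N \<in> \<int>" by (intro Ints_add) auto
    thus False using PD[OF that] by simp
  qed
  obtain p0 where "p0 \<in> P" using ne by blast
  hence cD: "c < D" using c(2) PD by fastforce
  let ?I = "\<lambda>c. LBINT t. barnes_integrand P x (Complex c t)"
  show "integrable lborel (\<lambda>t. barnes_integrand P x (Complex c t))"
    using line_shift(1)[OF c cD] PD by blast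
  have shift: "?I c = ?I (D + real N) + of_real (2 * pi) *
      of_real (\<Sum>p\<in>P. \<Sum>n | p + real n < D + real N. barnes_term P x p n)" for N
    using line_shift(3)[OF c _ PDN] cD by simp
  have iD: "integrable lborel (\<lambda>t. barnes_integrand P x (Complex (D + real N) t))" for N
    using line_shift(2)[OF c _ PDN] cD by simp
  have A: "(\<lambda>N. ?I (D + real N)) \<longlonglongrightarrow> 0"
  proof (rule Lim_null_comparison)
    have "norm (?I (D + real N)) \<le> x ^ N / fact N * (LBINT t. norm (barnes_integrand P x (Complex D t)))" for N
    proof -
      have "norm (?I (D + real N)) \<le> (LBINT t. norm (barnes_integrand P x (Complex (D + real N) t)))"
        by (rule integral_norm_bound)
      also have "\<dots> \<le> (LBINT t. x ^ N / fact N * norm (barnes_integrand P x (Complex D t)))"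
        using iD[of N] iD[of 0] norm_barnes_shift_right[OF PD]
        by (intro integral_mono integrable_mult_right integrable_norm) auto
      finally show ?thesis by simp
    qed
    thus "\<forall>\<^sub>F N in sequentially. norm (?I (D + real N)) \<le> x ^ N / fact N * (LBINT t. norm (barnes_integrand P x (Complex D t)))"
      by (intro always_eventually) auto
    have "(\<lambda>N. inverse (fact N) * x ^ N) \<longlonglongrightarrow> 0"
      using summable_LIMSEQ_zero[OF summable_exp[of x]] by simp
    from tendsto_mult_right[OF this, of "LBINT t. norm (barnes_integrand P x (Complex D t))"]
    show "(\<lambda>N. x ^ N / fact N * (LBINT t. norm (barnes_integrand P x (Complex D t)))) \<longlonglongrightarrow> 0"
      by (simp add: field_simps)
  qed
  have B: "(\<lambda>N. \<Sum>p\<in>P. \<Sum>n | p + real n < D + real N. barnes_term P x p n)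
      \<longlonglongrightarrow> (\<Sum>p\<in>P. \<Sum>n. barnes_term P x p n)"
  proof (rule tendsto_sum)
    fix p assume p: "p \<in> P"
    \<comment> \<open>The poles of one sequence left of the line form an initial segment whose
      length grows by one with \<open>N\<close>, so the residue sums are partial sums of the
      series.\<close>
    have eq: "{n. p + real n < D + real N} = {..<N + nat \<lceil>D - p\<rceil>}" for N
      using PD[OF p] by (auto simp: nat_less_iff) linarith+
    have "(\<lambda>N. \<Sum>n<N. barnes_term P x p n) \<longlonglongrightarrow> (\<Sum>n. barnes_term P x p n)"
      by (rule summable_LIMSEQ[OF summable[OF p]])
    thus "(\<lambda>N. \<Sum>n | p + real n < D + real N. barnes_term P x p n) \<longlonglongrightarrow> (\<Sum>n. barnes_term P x p n)"
      unfolding eq by (rule LIMSEQ_ignore_initial_segment)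
  qed
  have "(\<lambda>N. ?I (D + real N) + of_real (2 * pi) *
      of_real (\<Sum>p\<in>P. \<Sum>n | p + real n < D + real N. barnes_term P x p n)) \<longlonglongrightarrow>
      0 + of_real (2 * pi) * of_real (\<Sum>p\<in>P. \<Sum>n. barnes_term P x p n)"
    by (rule tendsto_add[OF A tendsto_mult_left[OF tendsto_of_real[OF B]]])
  hence "(\<lambda>N::nat. ?I c) \<longlonglongrightarrow> 0 + of_real (2 * pi) * of_real (\<Sum>p\<in>P. \<Sum>n. barnes_term P x p n)"
    by (simp only: shift[symmetric])
  from LIMSEQ_unique[OF tendsto_const this] show "?I c = of_real (2 * pi * (\<Sum>p\<in>P. \<Sum>n. barnes_term P x p n))"
    by simp
qed

end

section \<open>Residue series of two Gamma factors as hypergeometric series\<close>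

text \<open>Ratio test: the quotient of consecutive terms is of order
  \<open>1 / n\<^sup>2\<close>.\<close>

lemma summable_hypergeom_1F2:
  "summable (\<lambda>n. pochhammer p n / (pochhammer q n * pochhammer r n) * (x ^ n / fact n) :: real)"
proof -
  have "((\<lambda>n. \<bar>(p + real n) * x / ((q + real n) * (r + real n) * (real n + 1))\<bar>) \<longlongrightarrow> 0) sequentially"
    by (rule tendsto_rabs_zero) real_asymp
  hence "\<forall>\<^sub>F n in sequentially. \<bar>(p + real n) * x / ((q + real n) * (r + real n) * (real n + 1))\<bar> < 1/2"
    by (rule order_tendstoD) simp
  then obtain N where N: "\<And>n. n \<ge> N \<Longrightarrow> \<bar>(p + real n) * x / ((q + real n) * (r + real n) * (real n + 1))\<bar> < 1/2"
    unfolding eventually_sequentially by blast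
  show ?thesis
  proof (rule summable_ratio_test[of "1/2" N])
    fix n assume n: "n \<ge> N"
    let ?f = "\<lambda>n. pochhammer p n / (pochhammer q n * pochhammer r n) * (x ^ n / fact n)"
    \<comment> \<open>With division by zero equal to zero, this recurrence also holds when a lower
      parameter is a nonpositive integer; the terms then vanish eventually.\<close>
    have "?f (Suc n) = (p + real n) * x / ((q + real n) * (r + real n) * (real n + 1)) * ?f n"
      by (simp add: pochhammer_Suc divide_inverse inverse_mult_distrib mult_ac add_ac)
    hence "norm (?f (Suc n)) = \<bar>(p + real n) * x / ((q + real n) * (r + real n) * (real n + 1))\<bar> * norm (?f n)"
      by (simp only: real_norm_def abs_mult)
    also have "\<dots> \<le> 1/2 * norm (?f n)"
      using N[OF n] by (intro mult_right_mono) auto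
    finally show "norm (?f (Suc n)) \<le> 1/2 * norm (?f n)" .
  qed simp
qed

text \<open>The recurrence turns \<open>Gamma (a - m - n)\<close> into \<open>Gamma (a - m)\<close>
  over a Pochhammer symbol in \<open>m + 1 - a\<close>, with a sign that cancels the one of the
  residue. The factor \<open>1 / (m + n)\<close> equals
  \<open>pochhammer m n / (m * pochhammer (m + 1) n)\<close> and supplies the other two
  parameters.\<close>

lemma barnes_term_pair:
  fixes m a x :: real
  assumes "a - m \<notin> \<int>" "m > 0" "x > 0"
  shows "barnes_term {m, a} x m n = Gamma (a - m) * x powr m / m *
     (pochhammer m n / (pochhammer (m + 1 - a) n * pochhammer (m + 1) n) * (x ^ n / fact n))"
proof -
  have "a \<noteq> m" using assms(1) by auto
  hence P: "{m, a} - {m} = {a}" by auto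
  have nint: "a - m - real n \<notin> \<int>\<^sub>\<le>\<^sub>0"
  proof
    assume "a - m - real n \<in> \<int>\<^sub>\<le>\<^sub>0"
    hence "a - m - real n + real n \<in> \<int>" using nonpos_Ints_subset_Ints by (intro Ints_add) auto
    thus False using assms(1) by simp
  qed
  have "pochhammer (a - m - real n) n = (-1) ^ n * pochhammer (m + 1 - a) n"
    using pochhammer_minus[of "real n - (a - m)" n] by (simp add: algebra_simps)
  hence *: "Gamma (a - m) = (-1) ^ n * pochhammer (m + 1 - a) n * Gamma (a - m - real n)"
    using pochhammer_Gamma[OF nint, of n] nint by (simp add: Gamma_eq_zero_iff field_simps)
  have "Gamma (a - m) \<noteq> 0" using assms(1) nonpos_Ints_subset_Ints by (auto simp: Gamma_eq_zero_iff)
  hence nz: "pochhammer (m + 1 - a) n \<noteq> 0" using * by auto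
  have G: "Gamma (a - m - real n) = (-1) ^ n * Gamma (a - m) / pochhammer (m + 1 - a) n"
    using nz by (subst *) (simp add: power_mult_distrib[symmetric])
  have "m * pochhammer (m + 1) n = pochhammer m n * (m + real n)"
    using pochhammer_rec[of m n] pochhammer_rec'[of m n] by (simp add: mult.commute)
  moreover have "pochhammer (m + 1) n > 0" using assms by (intro pochhammer_pos) auto
  ultimately have eq: "m * pochhammer (m + 1) n = pochhammer m n * (m + real n)"
    and nz': "m * pochhammer (m + 1) n \<noteq> 0" "m + real n \<noteq> 0" using assms by auto
  have R: "1 / (m + real n) = pochhammer m n / (m * pochhammer (m + 1) n)"
    using eq by (subst frac_eq_eq[OF nz'(2,1)]) simp
  have "barnes_term {m, a} x m n = (-1) ^ n / fact n * Gamma (a - m - real n) * (x powr m * x ^ n) * (1 / (m + real n))"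
    using assms by (simp add: barnes_term_def P powr_add powr_realpow)
  also have "\<dots> = ((-1) ^ n * (-1) ^ n) * (Gamma (a - m) * x powr m / m *
     (pochhammer m n / (pochhammer (m + 1 - a) n * pochhammer (m + 1) n) * (x ^ n / fact n)))"
    unfolding G R by (simp add: divide_inverse inverse_mult_distrib mult_ac)
  also have "(-1) ^ n * (-1) ^ n = (1::real)" by (simp flip: power_mult_distrib)
  finally show ?thesis by simp
qed

lemma Mellin_Barnes_pair:
  assumes "a - m \<notin> \<int>" "0 < c" "c < m" "c < a" "x > 0"
  shows "(LBINT t. barnes_integrand {m, a} x (Complex c t)) = of_real (2 * pi * meijer_G_hypergeom m a x)"
proof -
  have ma: "m - a \<notin> \<int>" using assms(1) by (metis Ints_minus minus_diff_eq)
  have distinct: "m \<noteq> a" using assms(1) by auto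
  interpret barnes "{m, a}" x
    by standard (use assms ma in auto)
  have T1: "barnes_term {m, a} x m = (\<lambda>n. Gamma (a - m) * x powr m / m *
     (pochhammer m n / (pochhammer (m + 1 - a) n * pochhammer (m + 1) n) * (x ^ n / fact n)))"
    using assms by (intro ext barnes_term_pair) auto
  have T2: "barnes_term {m, a} x a = (\<lambda>n. Gamma (m - a) * x powr a / a *
     (pochhammer a n / (pochhammer (a + 1 - m) n * pochhammer (a + 1) n) * (x ^ n / fact n)))"
    using assms ma by (intro ext) (subst insert_commute, intro barnes_term_pair, auto)
  have S: "summable (barnes_term {m, a} x p)" if "p \<in> {m, a}" for p
    using that by (auto simp only: T1 T2 insert_iff empty_iff intro!: summable_mult summable_hypergeom_1F2)
  have "(\<Sum>p\<in>{m, a}. \<Sum>n. barnes_term {m, a} x p n) = meijer_G_hypergeom m a x"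
    using distinct unfolding meijer_G_hypergeom_def hypergeom_1F2_def
    by (simp only: T1 T2 suminf_mult[OF summable_hypergeom_1F2] sum.insert finite.intros sum.empty
          insert_iff empty_iff simp_thms add_0_right)
  with Mellin_Barnes_sum(2)[of c] assms S show ?thesis by auto
qed

subsection \<open>The incomplete Gamma function and its mixtures\<close>

text \<open>Absolute integrability refers to the completed measure, whereas Fubini is applied to
  \<open>lborel\<close>; Borel measurability bridges the two.\<close>

lemma set_integrable_lebesgue_imp_lborel:
  fixes f :: "'a::euclidean_space \<Rightarrow> 'b::euclidean_space"
  assumes "f absolutely_integrable_on A" "(\<lambda>x. indicator A x *\<^sub>R f x) \<in> borel_measurable borel"
  shows "integrable lborel (\<lambda>x. indicator A x *\<^sub>R f x)"
    and "(LBINT x. indicator A x *\<^sub>R f x) = integral A f"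
proof -
  show i: "integrable lborel (\<lambda>x. indicator A x *\<^sub>R f x)"
    using assms integrable_completion[of "\<lambda>x. indicator A x *\<^sub>R f x" lborel]
    by (simp add: set_integrable_def)
  hence "set_integrable lborel A f" by (simp add: set_integrable_def)
  from set_borel_integral_eq_integral(2)[OF this] show "(LBINT x. indicator A x *\<^sub>R f x) = integral A f"
    by (simp add: set_lebesgue_integral_def)
qed

definition lower_Gamma :: "real \<Rightarrow> real \<Rightarrow> real" where
  "lower_Gamma m y = (LBINT u. indicator {0..y} u * (u powr (m - 1) * exp (- u)))"

lemma powr_moment:
  fixes m y :: real
  assumes "m > 0" "y \<ge> 0"
  shows "has_bochner_integral lborel (\<lambda>u. indicator {0..y} u * u powr (m - 1)) (y powr m / m)"
proof (rule has_bochner_integral_nn_integral)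
  have "((\<lambda>u. u powr (m - 1)) has_integral (y powr m / m)) {0..y}"
    using has_integral_powr_from_0[of "m - 1" y] assms by simp
  from nn_integral_has_integral_lebesgue[OF _ this]
  show "(\<integral>\<^sup>+ u. indicator {0..y} u * u powr (m - 1) \<partial>lborel) = ennreal (y powr m / m)"
    by simp
qed (use assms in auto)

text \<open>Expand \<open>exp (- u)\<close> and integrate term by term. With \<open>P = {m}\<close>
  the product in \<open>barnes_term\<close> is empty, which leaves exactly the integrated Taylor
  terms.\<close>

lemma
  fixes m y :: real
  assumes m: "m > 0" and y: "y > 0"
  shows integrable_lower_Gamma: "integrable lborel (\<lambda>u. indicator {0..y} u * (u powr (m - 1) * exp (- u)))"
    and lower_Gamma_sums: "barnes_term {m} y m sums lower_Gamma m y"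
proof -
  define g where "g = (\<lambda>n u. (-1) ^ n / fact n * (indicator {0..y} u * u powr (m + real n - 1)) :: real)"
  have mom: "has_bochner_integral lborel (\<lambda>u. indicator {0..y} u * u powr (m + real n - 1)) (y powr (m + real n) / (m + real n))" for n
    using powr_moment[of "m + real n" y] m y by simp
  have gi: "integrable lborel (g n)" for n
    unfolding g_def using mom[of n] by (intro integrable_mult_right) (auto simp: has_bochner_integral_iff)
  have gint: "(LBINT u. g n u) = barnes_term {m} y m n" for n
    unfolding g_def barnes_term_def using mom[of n] by (simp add: has_bochner_integral_iff)
  have gnorm: "(LBINT u. norm (g n u)) = y powr (m + real n) / (m + real n) / fact n" for n
  proof -
    have "norm (g n u) = 1 / fact n * (indicator {0..y} u * u powr (m + real n - 1))" for u
      by (auto simp: g_def abs_mult indicator_def power_abs)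
    thus ?thesis using mom[of n] by (simp add: has_bochner_integral_iff)
  qed
  have gsums: "(\<lambda>n. g n u) sums (indicator {0..y} u * (u powr (m - 1) * exp (- u)))" for u
  \<comment> \<open>The point 0 is separate because \<open>0 powr _ = 0\<close>; both sides vanish
    there.\<close>
  proof (cases "u \<in> {0..y} \<and> u \<noteq> 0")
    case True
    hence "g n u = u powr (m - 1) * ((- u) ^ n /\<^sub>R fact n)" for n
      using powr_add[of u "m - 1" "real n"] powr_realpow[of u n] power_minus[of u n]
      by (simp add: g_def algebra_simps divide_inverse)
    moreover have "(\<lambda>n. u powr (m - 1) * ((- u) ^ n /\<^sub>R fact n)) sums (u powr (m - 1) * exp (- u))"
      by (intro sums_mult exp_converges)
    ultimately show ?thesis using True by simp
  next
    case False
    thus ?thesis by (auto simp: g_def)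
  qed
  have nn: "norm (g n u) \<le> indicator {0..y} u * u powr (m - 1) * (y ^ n / fact n)" for n u
  proof (cases "u \<in> {0..y} \<and> u \<noteq> 0")
    case True
    hence "u powr (m + real n - 1) = u powr (m - 1) * u ^ n"
      using powr_add[of u "m - 1" "real n"] powr_realpow[of u n] by (simp add: algebra_simps)
    thus ?thesis using True unfolding g_def
      by (auto simp: abs_mult power_abs intro!: mult_left_mono divide_right_mono power_mono)
  next
    case False
    thus ?thesis by (auto simp: g_def)
  qed
  have s1: "summable (\<lambda>n. norm (g n u))" for u
  proof (rule summable_comparison_test')
    show "summable (\<lambda>n. indicator {0..y} u * u powr (m - 1) * (y ^ n / fact n))"
      using summable_exp[of y] by (intro summable_mult) (simp add: divide_inverse mult.commute)
  qed (use nn in auto)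
  have s2: "summable (\<lambda>n. LBINT u. norm (g n u))"
  proof (rule summable_comparison_test')
    show "summable (\<lambda>n. y powr m / m * (y ^ n / fact n))"
      using summable_exp[of y] by (intro summable_mult) (simp add: divide_inverse mult.commute)
    fix n
    have "y powr (m + real n) / (m + real n) \<le> y powr m * y ^ n / m"
      using m y by (auto simp: powr_add powr_realpow intro!: divide_left_mono mult_pos_pos)
    from divide_right_mono[OF this, of "fact n"]
    show "norm (LBINT u. norm (g n u)) \<le> y powr m / m * (y ^ n / fact n)"
      unfolding gnorm using m y by simp
  qed
  have eq: "(\<Sum>n. g n u) = indicator {0..y} u * (u powr (m - 1) * exp (- u))" for u
    using gsums by (rule sums_unique[symmetric])
  show "integrable lborel (\<lambda>u. indicator {0..y} u * (u powr (m - 1) * exp (- u)))"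
    using integrable_suminf[OF gi _ s2] s1 by (simp add: eq)
  show "barnes_term {m} y m sums lower_Gamma m y"
    using sums_integral[OF gi _ s2] s1 by (simp add: eq gint lower_Gamma_def)
qed

text \<open>Mellin inversion for the incomplete Gamma function. For a singleton the non-integrality
  condition of the locale is vacuous, so every \<open>m > c\<close> is covered.\<close>

lemma Mellin_lower_Gamma:
  assumes "0 < c" "c < m" "y > 0"
  shows "integrable lborel (\<lambda>t. barnes_integrand {m} y (Complex c t))"
    and "(LBINT t. barnes_integrand {m} y (Complex c t)) = of_real (2 * pi * lower_Gamma m y)"
proof -
  interpret barnes "{m}" y by standard (use assms in auto)
  have S: "barnes_term {m} y m sums lower_Gamma m y"
    using assms by (intro lower_Gamma_sums) auto
  show "integrable lborel (\<lambda>t. barnes_integrand {m} y (Complex c t))"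
    using Mellin_Barnes_sum(1)[of c] assms sums_summable[OF S] by auto
  show "(LBINT t. barnes_integrand {m} y (Complex c t)) = of_real (2 * pi * lower_Gamma m y)"
    using Mellin_Barnes_sum(2)[of c] assms sums_summable[OF S] sums_unique[OF S] by auto
qed

lemma
  fixes z :: complex
  assumes "Re z > 0"
  shows integrable_Gamma_kernel: "integrable lborel (\<lambda>v. indicator {0<..} v *\<^sub>R (of_real v powr (z - 1) / of_real (exp v)))"
    and integral_Gamma_kernel: "(LBINT v. indicator {0<..} v *\<^sub>R (of_real v powr (z - 1) / of_real (exp v))) = Gamma z"
proof -
  have m: "(\<lambda>v. indicator {0<..} v *\<^sub>R (complex_of_real v powr (z - 1) / of_real (exp v))) \<in> borel_measurable borel"
  proof -
    \<comment> \<open>On the support the complex power is an exponential of \<open>ln v\<close>, for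
      which measurability is automatic.\<close>
    have "(\<lambda>v. indicator {0<..} v *\<^sub>R (exp ((z - 1) * of_real (ln v)) / of_real (exp v))) \<in> borel_measurable borel"
      by measurable
    also have "?this \<longleftrightarrow> ?thesis"
      by (intro measurable_cong) (auto simp: indicator_def powr_def Ln_of_real)
    finally show ?thesis .
  qed
  note * = set_integrable_lebesgue_imp_lborel[OF absolutely_integrable_Gamma_integral'[OF assms] m]
  show "integrable lborel (\<lambda>v. indicator {0<..} v *\<^sub>R (of_real v powr (z - 1) / of_real (exp v)))" by (rule *)
  show "(LBINT v. indicator {0<..} v *\<^sub>R (of_real v powr (z - 1) / of_real (exp v))) = Gamma z"
    using *(2) Gamma_integral_complex'[OF assms] by (simp add: integral_unique)
qed

text \<open>Insert Euler's integral for \<open>Gamma (a - s)\<close> and exchange the integrals. The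
  factor \<open>v powr (- s)\<close> combines with \<open>x powr s\<close> into
  \<open>(x / v) powr s\<close>, so at fixed \<open>v\<close> the inner integral is the Mellin
  integral of \<open>lower_Gamma m (x / v)\<close>.\<close>

lemma
  fixes m a c x :: real
  assumes c: "0 < c" "c < m" "c < a" and x: "x > 0"
  shows integrable_mixture_lower_Gamma:
      "integrable lborel (\<lambda>v. indicator {0<..} v * (v powr (a - 1) * exp (- v) * lower_Gamma m (x / v)))"
    and Mellin_Barnes_mixture:
      "(LBINT t. Gamma (of_real a - Complex c t) * barnes_integrand {m} x (Complex c t)) =
        of_real (2 * pi * (LBINT v. indicator {0<..} v * (v powr (a - 1) * exp (- v) * lower_Gamma m (x / v))))"
proof -
  define g where "g = (\<lambda>t. barnes_integrand {m} x (Complex c t))"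
  define k where "k = (\<lambda>t v. indicator {0<..} v *\<^sub>R
      (complex_of_real v powr (of_real a - Complex c t - 1) / of_real (exp v)))"
  define f where "f = (\<lambda>t v. g t * k t v)"
  have g: "integrable lborel g" unfolding g_def using Mellin_lower_Gamma(1)[of c m x] c x by simp
  have kint: "integrable lborel (k t)" "(LBINT v. k t v) = Gamma (of_real a - Complex c t)" for t
    unfolding k_def using c by (intro integrable_Gamma_kernel integral_Gamma_kernel; simp)+
  \<comment> \<open>The modulus of the kernel depends on \<open>Re s = c\<close> only, so absolute
    convergence of the double integral reduces to integrability of \<open>g\<close>.\<close>
  have knorm: "(LBINT v. norm (k t v)) = (LBINT v. norm (k 0 v))" for t
    by (intro Bochner_Integration.integral_cong refl)
       (auto simp: k_def indicator_def norm_divide norm_powr_real_powr)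
  have kmeas: "(\<lambda>(t, v). k t v) \<in> borel_measurable (lborel \<Otimes>\<^sub>M lborel)"
  proof -
    have "(\<lambda>(t, v). indicator {0<..} v *\<^sub>R
        (exp ((of_real a - (of_real c + \<i> * of_real t) - 1) * of_real (ln v)) / complex_of_real (exp v)))
        \<in> borel_measurable (lborel \<Otimes>\<^sub>M lborel)"
      by measurable
    also have "?this \<longleftrightarrow> ?thesis"
      by (intro measurable_cong) (auto simp: k_def indicator_def powr_def Ln_of_real Complex_eq)
    finally show ?thesis .
  qed
  have fint: "integrable (lborel \<Otimes>\<^sub>M lborel) (case_prod f)"
  proof (rule lborel_pair.Fubini_integrable)
    have "g \<in> borel_measurable lborel" using g by auto
    hence "(\<lambda>(t, v). g t) \<in> borel_measurable (lborel \<Otimes>\<^sub>M lborel)" by measurable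
    from borel_measurable_times[OF this kmeas]
    show "case_prod f \<in> borel_measurable (lborel \<Otimes>\<^sub>M lborel)"
      by (simp add: f_def case_prod_unfold)
    have "(LBINT v. norm (case_prod f (t, v))) = norm (g t) * (LBINT v. norm (k 0 v))" for t
      unfolding knorm[of t, symmetric] by (simp add: f_def norm_mult)
    moreover have "integrable lborel (\<lambda>t. norm (g t) * (LBINT v. norm (k 0 v)))"
      using g by (intro integrable_mult_left integrable_norm) auto
    ultimately show "integrable lborel (\<lambda>t. LBINT v. norm (case_prod f (t, v)))"
      by (simp only:)
    show "AE t in lborel. integrable lborel (\<lambda>v. case_prod f (t, v))"
      using kint(1) by (simp add: f_def)
  qed
  have inner: "(LBINT t. f t v) = of_real (2 * pi * (indicator {0<..} v * (v powr (a - 1) * exp (- v) * lower_Gamma m (x / v))))" for v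
  proof (cases "v > 0")
    case True
    have "f t v = of_real (v powr (a - 1) * exp (- v)) * barnes_integrand {m} (x / v) (Complex c t)" for t
    proof -
      define s where "s = Complex c t"
      have "complex_of_real v powr (of_real a - s - 1)
          = of_real v powr of_real (a - 1) * of_real v powr (- s)"
        unfolding powr_add[symmetric] by (rule arg_cong[of _ _ "\<lambda>e. of_real v powr e"]) simp
      hence 1: "complex_of_real v powr (of_real a - s - 1) = of_real (v powr (a - 1)) * of_real v powr (- s)"
        using True by (simp only: powr_of_real less_imp_le)
      have 2: "complex_of_real (x / v) powr s = of_real x powr s * of_real v powr (- s)"
      proof -
        have "s * of_real (ln (x / v)) = s * of_real (ln x) + (- s) * of_real (ln v)"
          using True x by (simp add: ln_div right_diff_distrib)
        thus ?thesis using True x by (simp add: powr_def Ln_of_real exp_add[symmetric] del: of_real_divide)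
      qed
      show ?thesis using True unfolding f_def g_def k_def barnes_integrand_def s_def[symmetric] 1 2
        by (simp add: exp_minus divide_inverse)
    qed
    thus ?thesis using True Mellin_lower_Gamma(2)[of c m "x / v"] c x by simp
  qed (simp add: f_def k_def)
  \<comment> \<open>Integrability of the mixture is a by-product of Fubini: up to the factor
    \<open>2 * pi\<close> it is the inner integral over \<open>t\<close>.\<close>
  have "integrable lborel (\<lambda>v. LBINT t. f t v)"
    by (rule lborel_pair.integrable_snd[OF fint])
  hence "integrable lborel (\<lambda>v. Re (LBINT t. f t v) / (2 * pi))" by (intro integrable_divide integrable_Re) auto
  thus int: "integrable lborel (\<lambda>v. indicator {0<..} v * (v powr (a - 1) * exp (- v) * lower_Gamma m (x / v)))"
    by (simp add: inner)
  have "(LBINT t. Gamma (of_real a - Complex c t) * barnes_integrand {m} x (Complex c t)) = (LBINT t. LBINT v. f t v)"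
    by (simp add: f_def kint(2) g_def mult.commute)
  also have "\<dots> = (LBINT v. LBINT t. f t v)"
    by (rule lborel_pair.Fubini_integral[OF fint, symmetric])
  also have "\<dots> = of_real (2 * pi * (LBINT v. indicator {0<..} v * (v powr (a - 1) * exp (- v) * lower_Gamma m (x / v))))"
    unfolding inner by (subst integral_complex_of_real) simp
  finally show "(LBINT t. Gamma (of_real a - Complex c t) * barnes_integrand {m} x (Complex c t)) =
        of_real (2 * pi * (LBINT v. indicator {0<..} v * (v powr (a - 1) * exp (- v) * lower_Gamma m (x / v))))" .
qed

subsection \<open>Products of Gamma variables\<close>

lemma gamma_density_rescale:
  assumes "\<theta> > 0"
  shows "\<theta> * gamma_density k \<theta> (\<theta> * x) = gamma_density k 1 x"
proof (cases "x > 0")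
  case True
  have "\<theta> powr k = \<theta> * \<theta> powr (k - 1)" using assms by (simp add: powr_mult_base)
  thus ?thesis using True assms by (simp add: gamma_density_def powr_mult)
next
  case False
  thus ?thesis using assms by (simp add: gamma_density_def zero_less_mult_iff)
qed

lemma (in prob_space) distributed_gamma_rescale:
  fixes X :: "'a \<Rightarrow> real"
  assumes "distributed M lborel X (gamma_density k \<theta>)" "\<theta> > 0"
  shows "distributed M lborel (\<lambda>\<omega>. X \<omega> / \<theta>) (gamma_density k 1)"
proof -
  have "distributed M lborel (\<lambda>\<omega>. 0 + (1 / \<theta>) * X \<omega>)
      (\<lambda>x. ennreal (gamma_density k \<theta> ((x - 0) / (1 / \<theta>))) / ennreal \<bar>1 / \<theta>\<bar>)"
    by (rule distributed_affine[OF assms(1)]) (use assms(2) in simp)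
  moreover have "ennreal (gamma_density k \<theta> ((x - 0) / (1 / \<theta>))) / ennreal \<bar>1 / \<theta>\<bar> = ennreal (gamma_density k 1 x)" for x
  proof -
    \<comment> \<open>The sign of \<open>Gamma k\<close> is open here; where the density is
      negative, both sides are truncated to 0 by \<open>ennreal\<close>.\<close>
    have "ennreal (gamma_density k \<theta> (x * \<theta>)) / ennreal (1 / \<theta>) = ennreal (gamma_density k \<theta> (x * \<theta>) / (1 / \<theta>))"
    proof (cases "gamma_density k \<theta> (x * \<theta>) \<ge> 0")
      case False
      thus ?thesis using assms(2) by (simp add: ennreal_neg mult_nonpos_nonneg)
    qed (use assms(2) in \<open>simp add: divide_ennreal\<close>)
    thus ?thesis using assms(2) gamma_density_rescale[of \<theta> k x] by (simp add: mult.commute)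
  qed
  ultimately show ?thesis by simp
qed

lemma lower_Gamma_nonneg: "lower_Gamma m y \<ge> 0"
  unfolding lower_Gamma_def by (intro integral_nonneg_AE AE_I2) auto

text \<open>Tonelli for the joint density: for fixed \<open>v > 0\<close> the event reads
  \<open>u \<le> x / v\<close>, and integrating over \<open>u\<close> gives
  \<open>lower_Gamma m (x / v) / Gamma m\<close>. The hypothesis \<open>int\<close> turns the outer
  nonnegative integral into a Lebesgue integral.\<close>

lemma (in prob_space) prob_gamma_product_le:
  fixes U V :: "'a \<Rightarrow> real" and m a x :: real
  assumes ind: "indep_var borel U borel V"
    and U: "distributed M lborel U (gamma_density m 1)"
    and V: "distributed M lborel V (gamma_density a 1)"
    and pos: "m > 0" "a > 0" "x > 0"
    and int: "integrable lborel (\<lambda>v. indicator {0<..} v * (v powr (a - 1) * exp (- v) * lower_Gamma m (x / v)))"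
  shows "prob {\<omega> \<in> space M. U \<omega> * V \<omega> \<le> x} =
    1 / (Gamma m * Gamma a) * (LBINT v. indicator {0<..} v * (v powr (a - 1) * exp (- v) * lower_Gamma m (x / v)))"
proof -
  define h where "h = (\<lambda>v. indicator {0<..} v * (v powr (a - 1) * exp (- v) * lower_Gamma m (x / v)))"
  have G: "Gamma m > 0" "Gamma a > 0" using pos by (auto intro: Gamma_real_pos)
  have dens: "gamma_density k 1 \<in> borel_measurable borel" for k
    unfolding gamma_density_def[abs_def] by measurable
  have "indep_var lborel (id \<circ> U) lborel (id \<circ> V)"
    by (rule indep_var_compose[OF ind]) auto
  hence ind': "indep_var lborel U lborel V" by simp
  have joint: "distributed M (lborel \<Otimes>\<^sub>M lborel) (\<lambda>\<omega>. (U \<omega>, V \<omega>))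
      (\<lambda>(u, v). ennreal (gamma_density m 1 u) * ennreal (gamma_density a 1 v))"
    by (rule distributed_joint_indep[OF _ _ U V ind']) (rule sigma_finite_lborel)+
  define A where "A = {p :: real \<times> real. fst p * snd p \<le> x}"
  have A: "A \<in> sets (lborel \<Otimes>\<^sub>M lborel)"
  proof -
    have "A = {p \<in> space (lborel \<Otimes>\<^sub>M lborel). fst p * snd p \<le> x}"
      by (auto simp: A_def space_pair_measure)
    also have "\<dots> \<in> sets (lborel \<Otimes>\<^sub>M lborel)" by measurable
    finally show ?thesis .
  qed
  let ?F = "\<lambda>p. (case p of (u, v) \<Rightarrow> ennreal (gamma_density m 1 u) * ennreal (gamma_density a 1 v)) * indicator A p"
  have Fm: "?F \<in> borel_measurable (lborel \<Otimes>\<^sub>M lborel)"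
    using dens A by measurable
  have inner: "(\<integral>\<^sup>+ u. ?F (u, v) \<partial>lborel) = ennreal (1 / (Gamma m * Gamma a) * h v)" for v
  proof (cases "v > 0")
    case True
    have "?F (u, v) = ennreal (gamma_density a 1 v) *
        ennreal (1 / Gamma m * (indicator {0..x / v} u * (u powr (m - 1) * exp (- u))))" for u
    proof (cases "u > 0")
      case u: True
      have "(u, v) \<in> A \<longleftrightarrow> u \<in> {0..x / v}" using u True by (auto simp: A_def pos_le_divide_eq)
      thus ?thesis using u G by (auto simp: gamma_density_def indicator_def mult.commute)
    next
      case False
      \<comment> \<open>At \<open>u = 0\<close> the indicator is 1, but
        \<open>0 powr (m - 1)\<close> is 0.\<close>
      thus ?thesis by (cases "u = 0") (auto simp: gamma_density_def)
    qed
    hence "(\<integral>\<^sup>+ u. ?F (u, v) \<partial>lborel) = ennreal (gamma_density a 1 v) *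
        (\<integral>\<^sup>+ u. ennreal (1 / Gamma m * (indicator {0..x / v} u * (u powr (m - 1) * exp (- u)))) \<partial>lborel)"
      by (simp add: nn_integral_cmult)
    also have "(\<integral>\<^sup>+ u. ennreal (1 / Gamma m * (indicator {0..x / v} u * (u powr (m - 1) * exp (- u)))) \<partial>lborel)
        = ennreal (LBINT u. 1 / Gamma m * (indicator {0..x / v} u * (u powr (m - 1) * exp (- u))))"
      using integrable_lower_Gamma[of m "x / v"] pos True G
      by (intro nn_integral_eq_integral integrable_mult_right AE_I2) auto
    also have "(LBINT u. 1 / Gamma m * (indicator {0..x / v} u * (u powr (m - 1) * exp (- u)))) =
        1 / Gamma m * lower_Gamma m (x / v)"
      unfolding lower_Gamma_def by (rule integral_mult_right_zero)
    also have "ennreal (gamma_density a 1 v) * ennreal (1 / Gamma m * lower_Gamma m (x / v)) =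
        ennreal (gamma_density a 1 v * (1 / Gamma m * lower_Gamma m (x / v)))"
      using True G by (intro ennreal_mult[symmetric]) (auto simp: gamma_density_def lower_Gamma_nonneg)
    finally show ?thesis using True by (simp add: h_def gamma_density_def mult_ac)
  next
    case False
    thus ?thesis by (simp add: h_def gamma_density_def)
  qed
  have "emeasure M {\<omega> \<in> space M. U \<omega> * V \<omega> \<le> x} = emeasure M ((\<lambda>\<omega>. (U \<omega>, V \<omega>)) -` A \<inter> space M)"
    by (rule arg_cong[of _ _ "emeasure M"]) (auto simp: A_def)
  also have "\<dots> = (\<integral>\<^sup>+ p. ?F p \<partial>(lborel \<Otimes>\<^sub>M lborel))"
    by (rule distributed_emeasure[OF joint A])
  also have "\<dots> = (\<integral>\<^sup>+ v. \<integral>\<^sup>+ u. ?F (u, v) \<partial>lborel \<partial>lborel)"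
    by (rule lborel_pair.nn_integral_snd[OF Fm, symmetric])
  also have "\<dots> = (\<integral>\<^sup>+ v. ennreal (1 / (Gamma m * Gamma a) * h v) \<partial>lborel)"
    by (simp only: inner)
  also have "\<dots> = ennreal (LBINT v. 1 / (Gamma m * Gamma a) * h v)"
    using int G by (intro nn_integral_eq_integral integrable_mult_right AE_I2)
      (auto simp: h_def lower_Gamma_nonneg)
  also have "(LBINT v. 1 / (Gamma m * Gamma a) * h v) = 1 / (Gamma m * Gamma a) * (LBINT v. h v)"
    by (rule integral_mult_right_zero)
  finally have *: "emeasure M {\<omega> \<in> space M. U \<omega> * V \<omega> \<le> x} = ennreal (1 / (Gamma m * Gamma a) * (LBINT v. h v))" .
  have "(LBINT v. h v) \<ge> 0" by (intro integral_nonneg_AE AE_I2) (auto simp: h_def lower_Gamma_nonneg)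
  with * G show ?thesis unfolding measure_def h_def by (simp add: enn2real_ennreal)
qed

section \<open>Continuity in the shape parameter\<close>

text \<open>Dominated convergence: on the line, \<open>Gamma (b - s)\<close> is at most
  \<open>Gamma (b - c)\<close> in modulus, which stays bounded for \<open>b\<close> near
  \<open>a\<close>. \<open>H\<close> is prescribed only away from \<open>a\<close>, since it will be
  a closed form that degenerates there.\<close>

lemma tendsto_integral_Gamma_parameter:
  fixes g :: "real \<Rightarrow> complex"
  assumes g: "integrable lborel g" and c: "c < a" and \<delta>: "0 < \<delta>"
    and H: "\<And>b. b \<noteq> a \<Longrightarrow> \<bar>b - a\<bar> < \<delta> \<Longrightarrow> c < b \<Longrightarrow> H b = (LBINT t. Gamma (of_real b - Complex c t) * g t)"
  shows "(H \<longlongrightarrow> (LBINT t. Gamma (of_real a - Complex c t) * g t)) (at a)"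
proof -
  \<comment> \<open>Half the distance to \<open>c\<close> keeps \<open>b - c\<close> in a compact
    interval away from the pole of Gamma at 0.\<close>
  define e where "e = min \<delta> ((a - c) / 2)"
  have e: "e > 0" "e \<le> \<delta>" using c \<delta> by (auto simp: e_def)
  have e_le: "e \<le> (a - c) / 2" unfolding e_def by (rule min.cobounded2)
  have meas: "(\<lambda>t. Gamma (of_real b - Complex c t)) \<in> borel_measurable borel" if "b > c" for b
  proof (intro borel_measurable_continuous_onI continuous_on_compose2[OF continuous_on_Gamma])
    show "continuous_on UNIV (\<lambda>t. of_real b - Complex c t)" unfolding Complex_eq by (intro continuous_intros)
    show "{z. Re z > 0} \<inter> \<int>\<^sub>\<le>\<^sub>0 = ({} :: complex set)" by (auto elim!: nonpos_Ints_cases)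
  qed (use that in auto)
  have "bounded (Gamma ` {(a - c) / 2..2 * (a - c)})"
    using c by (intro compact_imp_bounded compact_continuous_image continuous_on_Gamma)
      (auto elim!: nonpos_Ints_cases)
  then obtain K where K: "\<And>y. y \<in> {(a - c) / 2..2 * (a - c)} \<Longrightarrow> norm (Gamma y) \<le> K"
    unfolding bounded_iff by blast
  have "(H \<longlongrightarrow> (LBINT t. Gamma (of_real a - Complex c t) * g t)) (at a within ball a e)"
    unfolding tendsto_at_iff_sequentially
  proof (intro allI impI)
    fix X :: "nat \<Rightarrow> real" assume X: "\<forall>i. X i \<in> ball a e - {a}" and lim: "X \<longlonglongrightarrow> a"
    have Xi: "X i \<noteq> a" "\<bar>X i - a\<bar> < e" for i using X[rule_format, of i] by (auto simp: dist_real_def)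
    have Xc: "X i - c \<in> {(a - c) / 2..2 * (a - c)}" "X i > c" for i using Xi(2)[of i] e_le c by auto
    have "(\<lambda>i. LBINT t. Gamma (of_real (X i) - Complex c t) * g t) \<longlonglongrightarrow> (LBINT t. Gamma (of_real a - Complex c t) * g t)"
    proof (rule integral_dominated_convergence[where w = "\<lambda>t. K * norm (g t)"])
      show "integrable lborel (\<lambda>t. K * norm (g t))" using g by (intro integrable_mult_right integrable_norm)
      have gm: "g \<in> borel_measurable lborel" using g by auto
      show "(\<lambda>t. Gamma (of_real a - Complex c t) * g t) \<in> borel_measurable lborel"
        using meas[OF c] gm by simp
      show "(\<lambda>t. Gamma (of_real (X i) - Complex c t) * g t) \<in> borel_measurable lborel" for i
        using meas[OF Xc(2)[of i]] gm by simp
      show "AE t in lborel. (\<lambda>i. Gamma (of_real (X i) - Complex c t) * g t) \<longlonglongrightarrow> Gamma (of_real a - Complex c t) * g t"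
        using c by (intro AE_I2 tendsto_intros lim) (auto elim!: nonpos_Ints_cases simp: complex_eq_iff)
      show "AE t in lborel. norm (Gamma (of_real (X i) - Complex c t) * g t) \<le> K * norm (g t)" for i
      proof (intro AE_I2)
        fix t
        have "norm (Gamma (of_real (X i) - Complex c t)) \<le> K"
          using norm_Gamma_le[of "of_real (X i) - Complex c t"] K[OF Xc(1)[of i]] Xc(2)[of i] by auto
        thus "norm (Gamma (of_real (X i) - Complex c t) * g t) \<le> K * norm (g t)"
          unfolding norm_mult by (intro mult_right_mono) auto
      qed
    qed
    moreover have "H (X i) = (LBINT t. Gamma (of_real (X i) - Complex c t) * g t)" for i
      using Xi[of i] Xc(2)[of i] e by (intro H) auto
    ultimately show "(H \<circ> X) \<longlonglongrightarrow> (LBINT t. Gamma (of_real a - Complex c t) * g t)"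
      by (simp add: o_def)
  qed
  moreover have "at a within ball a e = at a" using e by (intro at_within_open) auto
  ultimately show ?thesis by simp
qed

section \<open>The Meijer G-function and the distribution of the ratio\<close>

text \<open>\<open>Gamma (1 + s) = s * Gamma s\<close> reduces the quotient to \<open>1 / s\<close>.
  Keeping \<open>Gamma (a - s)\<close> outside \<open>barnes_integrand\<close> covers
  \<open>a = m\<close>, where the set \<open>{m, a}\<close> collapses to a singleton.\<close>

lemma meijer_G_eq_Mellin_Barnes:
  assumes "c > 0"
  shows "meijer_G_2113 c m a x =
    (LBINT t. Gamma (of_real a - Complex c t) * barnes_integrand {m} x (Complex c t)) / of_real (2 * pi)"
proof -
  have eq: "(let s = Complex c t in
        Gamma (complex_of_real m - s) * Gamma (complex_of_real a - s) * Gamma s / Gamma (1 + s)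
        * complex_of_real x powr s) * \<i> =
      (Gamma (of_real a - Complex c t) * barnes_integrand {m} x (Complex c t)) * \<i>" for t
  proof -
    define s where "s = Complex c t"
    have "s \<notin> \<int>\<^sub>\<le>\<^sub>0" using assms by (auto simp: s_def complex_eq_iff elim!: nonpos_Ints_cases)
    hence "Gamma (1 + s) = s * Gamma s" "Gamma s \<noteq> 0"
      using Gamma_plus1[of s] by (auto simp: Gamma_eq_zero_iff add.commute)
    thus ?thesis unfolding s_def[symmetric] Let_def barnes_integrand_def by simp
  qed
  show ?thesis unfolding meijer_G_2113_def eq by simp
qed

lemma meijer_G_eq_hypergeom:
  assumes "a - m \<notin> \<int>" "0 < c" "c < m" "c < a" "x > 0"
  shows "meijer_G_2113 c m a x = of_real (meijer_G_hypergeom m a x)"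
proof -
  have "m \<noteq> a" using assms(1) by auto
  hence "barnes_integrand {m, a} x s = Gamma (of_real a - s) * barnes_integrand {m} x s" for s
    by (simp add: barnes_integrand_def)
  thus ?thesis using Mellin_Barnes_pair[OF assms] assms
    by (simp add: meijer_G_eq_Mellin_Barnes)
qed

text \<open>For integer \<open>a - m\<close> the hypergeometric expression meets poles of Gamma, so
  there the second identity is read as a limit in the parameter \<open>a\<close>.\<close>

theorem mainTheorem7:
  fixes M :: "'w measure" and S I :: "'w \<Rightarrow> real" and m a \<theta> b \<gamma> c :: real
  assumes "prob_space M"
    and "m > 0" and "a > 0" and "\<theta> > 0" and "b > 0"
    and "AE \<omega> in M. S \<omega> > 0" and "AE \<omega> in M. I \<omega> > 0"
    and "prob_space.indep_var M borel S borel I"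
    and "distributed M lborel S (gamma_density m \<theta>)"
    and "distributed M lborel (\<lambda>\<omega>. inverse (I \<omega>)) (gamma_density a (1 / b))"
    and "\<gamma> > 0"
    and "0 < c" and "c < min m a"
  shows "complex_of_real (measure M {\<omega> \<in> space M. b / \<theta> * (S \<omega> / I \<omega>) \<le> \<gamma>})
           = 1 / complex_of_real (Gamma m * Gamma a) * meijer_G_2113 c m a \<gamma>
    \<and> (a - m \<notin> \<int> \<longrightarrow>
           meijer_G_2113 c m a \<gamma> = complex_of_real (meijer_G_hypergeom m a \<gamma>))
    \<and> (a - m \<in> \<int> \<longrightarrow>
           ((\<lambda>a'. complex_of_real (meijer_G_hypergeom m a' \<gamma>)) \<longlongrightarrow> meijer_G_2113 c m a \<gamma>) (at a))"
proof (intro conjI impI)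
  interpret prob_space M by fact
  have cm: "c < m" "c < a" using \<open>c < min m a\<close> by auto
  define h where "h = (LBINT v. indicator {0<..} v * (v powr (a - 1) * exp (- v) * lower_Gamma m (\<gamma> / v)))"
  \<comment> \<open>Both variables are brought to unit scale; their product is the normalized
    ratio.\<close>
  have ind: "indep_var borel (\<lambda>\<omega>. S \<omega> / \<theta>) borel (\<lambda>\<omega>. inverse (I \<omega>) / (1 / b))"
    using indep_var_compose[OF assms(8), of "\<lambda>s. s / \<theta>" borel "\<lambda>y. inverse y / (1 / b)" borel]
    by (simp add: o_def)
  have "prob {\<omega> \<in> space M. S \<omega> / \<theta> * (inverse (I \<omega>) / (1 / b)) \<le> \<gamma>} = 1 / (Gamma m * Gamma a) * h"
    unfolding h_def
    by (rule prob_gamma_product_le[OF ind distributed_gamma_rescale distributed_gamma_rescale])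
       (use assms cm integrable_mixture_lower_Gamma[of c m a \<gamma>] in auto)
  also have "(\<lambda>\<omega>. S \<omega> / \<theta> * (inverse (I \<omega>) / (1 / b))) = (\<lambda>\<omega>. b / \<theta> * (S \<omega> / I \<omega>))"
    by (simp add: fun_eq_iff divide_inverse mult_ac)
  finally have P: "prob {\<omega> \<in> space M. b / \<theta> * (S \<omega> / I \<omega>) \<le> \<gamma>} = 1 / (Gamma m * Gamma a) * h"
    by (metis (no_types, lifting))
  have "meijer_G_2113 c m a \<gamma> = of_real h"
    using meijer_G_eq_Mellin_Barnes[of c m a \<gamma>] Mellin_Barnes_mixture[of c m a \<gamma>] assms cm
    by (simp add: h_def)
  thus "complex_of_real (measure M {\<omega> \<in> space M. b / \<theta> * (S \<omega> / I \<omega>) \<le> \<gamma>})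
           = 1 / complex_of_real (Gamma m * Gamma a) * meijer_G_2113 c m a \<gamma>"
    unfolding P by simp
  show "meijer_G_2113 c m a \<gamma> = complex_of_real (meijer_G_hypergeom m a \<gamma>)" if "a - m \<notin> \<int>"
    using meijer_G_eq_hypergeom[OF that] assms cm by auto
  show "((\<lambda>a'. complex_of_real (meijer_G_hypergeom m a' \<gamma>)) \<longlongrightarrow> meijer_G_2113 c m a \<gamma>) (at a)" if "a - m \<in> \<int>"
  proof -
    define g where "g = (\<lambda>t. barnes_integrand {m} \<gamma> (Complex c t))"
    have g: "integrable lborel g" unfolding g_def using Mellin_lower_Gamma(1) assms cm by auto
    have "((\<lambda>a'. of_real (2 * pi) * complex_of_real (meijer_G_hypergeom m a' \<gamma>)) \<longlongrightarrow>
        (LBINT t. Gamma (of_real a - Complex c t) * g t)) (at a)"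
    proof (rule tendsto_integral_Gamma_parameter[OF g cm(2) zero_less_one])
      fix a' assume a': "a' \<noteq> a" "\<bar>a' - a\<bar> < 1" "c < a'"
      \<comment> \<open>A nonzero shift by less than 1 leaves the integers, so the closed form is
        available at \<open>a'\<close>.\<close>
      have "a' - m \<notin> \<int>"
      proof
        assume "a' - m \<in> \<int>"
        hence "(a' - m) - (a - m) \<in> \<int>" using that by (rule Ints_diff)
        hence "a' - a \<in> \<int>" by simp
        thus False using a' Ints_nonzero_abs_less1 by fastforce
      qed
      from meijer_G_eq_hypergeom[OF this \<open>0 < c\<close> cm(1) a'(3) \<open>\<gamma> > 0\<close>]
      show "of_real (2 * pi) * complex_of_real (meijer_G_hypergeom m a' \<gamma>) =
          (LBINT t. Gamma (of_real a' - Complex c t) * g t)"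
        using meijer_G_eq_Mellin_Barnes[OF \<open>0 < c\<close>, of m a' \<gamma>] by (simp add: g_def field_simps)
    qed
    from tendsto_divide[OF this tendsto_const[of "of_real (2 * pi)"]]
    show ?thesis by (simp add: meijer_G_eq_Mellin_Barnes[OF \<open>0 < c\<close>] g_def)
  qed
qed

end
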